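(* Let $K\subset\mathbb{R}^2$ be a centrally symmetric strictly convex planar body with $C^1$ boundary. If $K$ floats in equilibrium in every orientation with perimetral density $\sigma=\frac18$ or $\sigma=\frac38$, then $K$ is a disk.
   Context: A planar body is a compact convex subset of $\mathbb{R}^2$ with nonempty interior. It is centrally symmetric if $K$ is invariant under the reflection $x\mapsto 2c-x$ for some point $c$. Let $P$ be the perimeter of $K$ and let $\gamma:\mathbb{R}/P\mathbb{Z}\to\partial K$ be an arc-length parametrization of its boundary. For $0<\sigma<1$, "$K$ floats in equilibrium in every orientation with perimetral density $\sigma$" means (Auerbach's formulation) that the waterlines are exactly the chords of $K$ cutting $\partial K$ into two arcs whose lengths are in the ratio $\sigma:(1-\sigma)$, and that all these chords have the same length; equivalently, $|\gamma(t+\sigma P)-\gamma(t)|$ is independent of $t$. *)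

theory Defs
  imports "HOL-Analysis.Analysis"
begin

definition planar_body :: "(real ^ 2) set \<Rightarrow> bool" where
  "planar_body K \<longleftrightarrow> compact K \<and> convex K \<and> interior K \<noteq> {}"

definition centrally_symmetric :: "(real ^ 2) set \<Rightarrow> bool" where
  "centrally_symmetric K \<longleftrightarrow> (\<exists>c. (\<lambda>x. 2 *\<^sub>R c - x) ` K = K)"

definition strictly_convex :: "(real ^ 2) set \<Rightarrow> bool" where
  "strictly_convex K \<longleftrightarrow>
     (\<forall>x\<in>K. \<forall>y\<in>K. x \<noteq> y \<longrightarrow> open_segment x y \<subseteq> interior K)"

text \<open>Functions on the circle of length \<open>L\<close> are encoded as \<open>L\<close>-periodic functions on the
  real line.\<close>

definition parametrizes_boundary :: "(real \<Rightarrow> real ^ 2) \<Rightarrow> real \<Rightarrow> (real ^ 2) set \<Rightarrow> bool" where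
  "parametrizes_boundary \<gamma> L K \<longleftrightarrow>
     0 < L \<and> (\<forall>t. \<gamma> (t + L) = \<gamma> t) \<and> inj_on \<gamma> {0..<L} \<and> range \<gamma> = frontier K"

text \<open>The boundary is a simple closed regular curve of class \<open>C\<^sup>1\<close>; the parameter need not be
  arc length.\<close>

definition C1_boundary :: "(real ^ 2) set \<Rightarrow> bool" where
  "C1_boundary K \<longleftrightarrow>
     (\<exists>\<phi> L. parametrizes_boundary \<phi> L K \<and> \<phi> C1_differentiable_on UNIV \<and>
            (\<forall>t. vector_derivative \<phi> (at t) \<noteq> 0))"

text \<open>The supremum of the lengths of inscribed polygonal lines; it is extended-real valued, so
  that it is infinite for curves that are not rectifiable.\<close>

definition arc_length :: "(real \<Rightarrow> 'a::metric_space) \<Rightarrow> real \<Rightarrow> real \<Rightarrow> ereal" where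
  "arc_length \<gamma> a b =
     Sup {ereal (\<Sum>i<n. dist (\<gamma> (u i)) (\<gamma> (u (Suc i)))) | n u. mono u \<and> u 0 = a \<and> u n = b}"

text \<open>The last condition forces \<open>P\<close> to be the perimeter of \<open>K\<close> (take \<open>s = 0\<close> and \<open>t = P\<close>), and
  it implies that \<open>\<gamma>\<close> is continuous.\<close>

definition arc_length_parametrization ::
    "(real \<Rightarrow> real ^ 2) \<Rightarrow> real \<Rightarrow> (real ^ 2) set \<Rightarrow> bool" where
  "arc_length_parametrization \<gamma> P K \<longleftrightarrow>
     parametrizes_boundary \<gamma> P K \<and> (\<forall>s t. s \<le> t \<longrightarrow> arc_length \<gamma> s t = ereal (t - s))"

text \<open>Such a \<open>\<gamma>\<close> is unique up to a shift and a reversal of the parameter, so the condition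
  does not depend on its choice.\<close>

definition floats_in_equilibrium :: "(real ^ 2) set \<Rightarrow> real \<Rightarrow> bool" where
  "floats_in_equilibrium K \<sigma> \<longleftrightarrow>
     (\<exists>\<gamma> P. arc_length_parametrization \<gamma> P K \<and>
            (\<exists>d. \<forall>t. norm (\<gamma> (t + \<sigma> * P) - \<gamma> t) = d))"

end

theory Submission
  imports Defs
begin

text \<open>Put the center at \<open>0\<close>, let \<open>T = \<sigma> P\<close>, and let \<open>\<delta> t\<close> be the angle between the tangent at
  \<open>\<gamma> t\<close> and the chord from \<open>\<gamma> t\<close> to \<open>\<gamma> (t + T)\<close>; since the chord length \<open>d\<close> is constant, the
  tangent at the other end makes the same angle with the chord, which rotates at the rate
  \<open>2 sin \<delta> / d\<close>. Because \<open>\<gamma> (t + 4 T)\<close> is the antipode of \<open>\<gamma> t\<close>, the four angles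
  \<open>\<delta>\<^sub>k = \<delta> (t + k T)\<close>, \<open>k < 4\<close>, have the constant sum \<open>4 \<sigma> \<pi>\<close>, and differentiating
  the sum of \<open>\<delta>\<^sub>0 + \<delta>\<^sub>1\<close> and \<open>\<delta>\<^sub>2 + \<delta>\<^sub>3\<close>, the angles between consecutive chords, yields \<open>sin \<delta>\<^sub>0 + sin \<delta>\<^sub>2 = sin \<delta>\<^sub>1 + sin \<delta>\<^sub>3\<close>. Hence
  \<open>z = (\<delta>\<^sub>1 - \<delta>\<^sub>3) / 2 + \<i> (\<delta>\<^sub>0 - \<delta>\<^sub>2) / 2\<close> satisfies an autonomous equation which is nearly a
  rotation around \<open>0\<close>, and \<open>z (t + T) = \<i> z t\<close>. The angle by which the equation turns \<open>z\<close> during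
  a time \<open>T\<close> is incompatible with a quarter turn, so \<open>z = 0\<close>, \<open>\<delta>\<close> is constant, and
  \<open>\<gamma> (t + 4 T) - \<gamma> t = - 2 \<gamma> t\<close> is a sum of four chords in a rigid configuration, whence \<open>norm (\<gamma> t)\<close> is
  constant.\<close>

subsection \<open>Auxiliary estimates\<close>

lemma unit_eq_cis_arccos:
  fixes z :: complex
  assumes "norm z = 1" "0 < Im z"
  shows "z = cis (arccos (Re z))" "0 < arccos (Re z)" "arccos (Re z) < pi"
proof -
  have s: "(Re z)\<^sup>2 + (Im z)\<^sup>2 = 1"
    using assms(1) cmod_power2[of z] by simp
  have "(Im z)\<^sup>2 > 0" using assms(2) by simp
  then have "(Re z)\<^sup>2 < 1" using s by linarith
  then have r: "-1 < Re z" "Re z < 1" by (auto simp: power2_less_1_iff abs_less_iff)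
  have "sqrt (1 - (Re z)\<^sup>2) = Im z"
    using s assms(2) by (intro real_sqrt_unique) auto
  then show "z = cis (arccos (Re z))" using r by (simp add: complex_eq_iff sin_arccos_abs)
  show "0 < arccos (Re z)" "arccos (Re z) < pi"
    using arccos_lt_bounded[OF r] by auto
qed

lemma cos_eq_1_imp_zero:
  fixes x :: real
  assumes "cos x = 1" "\<bar>x\<bar> < 2 * pi"
  shows "x = 0"
proof -
  obtain n :: nat where n: "\<bar>x\<bar> = n * 2 * pi" using assms(1) by (auto simp: cos_one_2pi)
  then have "real n * (2 * pi) < 1 * (2 * pi)" using assms(2) by simp
  then have "n = 0" by (subst (asm) mult_less_cancel_right_pos) auto
  then show ?thesis using n by simp
qed

lemma norm_sum_sq_bound:
  fixes x y a b c :: real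
  assumes "\<bar>x\<bar> \<le> c * \<bar>a\<bar>" "\<bar>y\<bar> \<le> c * \<bar>b\<bar>" "0 \<le> c"
  shows "norm (Complex x y) \<le> c * norm (Complex a b)"
proof -
  have "x\<^sup>2 \<le> (c * a)\<^sup>2" "y\<^sup>2 \<le> (c * b)\<^sup>2"
    using power_mono[OF assms(1), of 2] power_mono[OF assms(2), of 2]
    by (auto simp: power_mult_distrib)
  then have "x\<^sup>2 + y\<^sup>2 \<le> c\<^sup>2 * (a\<^sup>2 + b\<^sup>2)" by (simp add: power_mult_distrib algebra_simps)
  then have "sqrt (x\<^sup>2 + y\<^sup>2) \<le> sqrt (c\<^sup>2 * (a\<^sup>2 + b\<^sup>2))" by (rule real_sqrt_le_mono)
  then show ?thesis using assms(3) by (simp add: complex_norm real_sqrt_mult)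
qed

text \<open>The balance \<open>sin A * cos a = sin B * cos b\<close> forces \<open>tan A\<close> and
  \<open>tan B\<close> to be at most 4/9. For nonzero \<open>a\<close> this puts
  \<open>cos A * sin a / a\<close> between \<open>9 / 4 * q\<close> and \<open>23 / 4 * q\<close>.
  The midpoint \<open>4 * q\<close> is what the rotating frame in \<open>z_zero\<close>
  removes.\<close>

lemma trig_eighth:
  fixes A B a b q :: real
  assumes AB: "A + B = pi / 4" "\<bar>a\<bar> < A" "\<bar>b\<bar> < B"
    and q: "q = sin A * cos a" "q = sin B * cos b"
  shows "\<bar>cos A * sin a - 4 * q * a\<bar> \<le> 7 / 4 * q * \<bar>a\<bar>"
proof -
  have tan_le: "9 * sin y \<le> 4 * cos y"
    if "x + y = pi / 4" "\<bar>s\<bar> < x" "\<bar>t\<bar> < y" "sin x * cos s = sin y * cos t" for x y s t :: real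
  proof (rule ccontr)
    \<comment> \<open>\<open>tan y > 4 / 9\<close> alone gives
      \<open>(sin y)\<^sup>2 > 16 / 97\<close>; inserted into the balance it gives
      \<open>(sin y)\<^sup>2 < 25 / 162\<close>, which is smaller.\<close>
    assume n: "\<not> 9 * sin y \<le> 4 * cos y"
    have x: "x = pi / 4 - y" using that by simp
    have y: "0 < y" "y < pi / 4" using that by auto
    have sp: "0 < sin y" and cp: "0 < cos y"
      using y by (auto intro!: sin_gt_zero cos_gt_zero)
    have sx: "0 < sin x" using that by (intro sin_gt_zero) auto
    have "cos y \<le> cos \<bar>t\<bar>" using y that by (intro cos_monotone_0_pi_le) auto
    then have "sin y * cos y \<le> sin y * cos t" using sp by simp
    also have "\<dots> \<le> sin x" using that(4)[symmetric] sx by (simp add: mult_left_le)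
    also have "\<dots> = (cos y - sin y) * (sqrt 2 / 2)"
      unfolding x sin_diff by (simp add: cos_45 sin_45 algebra_simps)
    also have "\<dots> < (5 / 9 * cos y) * (sqrt 2 / 2)"
      using n by (intro mult_strict_right_mono) auto
    finally have "cos y * sin y < cos y * (5 / 18 * sqrt 2)" by (simp add: algebra_simps)
    then have "sin y < 5 / 18 * sqrt 2" using cp by simp
    then have "(sin y)\<^sup>2 < (5 / 18 * sqrt 2)\<^sup>2" using sp by (intro power_strict_mono) auto
    then have s1: "(sin y)\<^sup>2 < 25 / 162" by (simp add: power_mult_distrib power_divide)
    have "(4 * cos y)\<^sup>2 < (9 * sin y)\<^sup>2" using n cp by (intro power_strict_mono) auto
    then have "16 * (1 - (sin y)\<^sup>2) < 81 * (sin y)\<^sup>2"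
      by (simp add: power_mult_distrib cos_squared_eq)
    with s1 show False by simp
  qed
  have tA: "9 * sin A \<le> 4 * cos A" using tan_le[of B A b a] assms by auto
  have tB: "9 * sin B \<le> 4 * cos B" using tan_le[of A B a b] assms by auto
  have A0: "0 < A" "A < pi / 4" using assms by auto
  have sA: "0 < sin A" and cA: "0 < cos A" using A0 by (auto intro!: sin_gt_zero cos_gt_zero)
  have B: "B = pi / 4 - A" using AB by simp
  \<comment> \<open>The bound on \<open>tan B\<close>, rewritten with \<open>B = pi / 4 - A\<close>,
    becomes the upper bound 13/5 for the cotangent of \<open>A\<close>.\<close>
  have "9 * (cos A - sin A) * (sqrt 2 / 2) \<le> 4 * (cos A + sin A) * (sqrt 2 / 2)"
    using tB unfolding B sin_diff cos_diff cos_45 sin_45 by (simp add: algebra_simps)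
  then have "9 * (cos A - sin A) \<le> 4 * (cos A + sin A)"
    by (rule mult_right_le_imp_le) simp
  then have lA: "5 * cos A \<le> 13 * sin A" by simp
  have ca: "1 / 2 \<le> cos a"
  proof -
    have "cos (pi / 3) \<le> cos \<bar>a\<bar>" using AB A0 pi_gt_zero by (intro cos_monotone_0_pi_le) auto
    then show ?thesis by (simp add: cos_60)
  qed
  have main: "\<bar>cos A * sin c - 4 * q * c\<bar> \<le> 7 / 4 * q * c" if c: "0 \<le> c" "c < A" "cos c = cos a" for c
  proof -
    have qq: "q = sin A * cos c" using q c by simp
    have "c * cos c \<le> sin c"
    proof (cases "c = 0")
      case False
      have cc: "0 < cos c" using ca c by simp
      have "0 \<le> tan c" using c A0 False by (intro less_imp_le tan_gt_zero) auto
      then have "c \<le> tan c" using abs_tan_ge[of c] c A0 by simp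
      then show ?thesis using cc by (simp add: tan_def field_simps)
    qed auto
    then have "9 * sin A * (c * cos c) \<le> 4 * cos A * sin c"
      using tA sA cA c ca by (intro mult_mono[of "9 * sin A"]) auto
    then have lo: "9 * q * c \<le> 4 * (cos A * sin c)" unfolding qq by (simp add: algebra_simps)
    have "cos A * sin c \<le> 13 / 5 * sin A * c"
      using lA cA c sA A0 sin_x_le_x[of c] by (intro mult_mono) (auto intro!: sin_ge_zero)
    also have "\<dots> \<le> 23 / 4 * q * c"
    proof -
      \<comment> \<open>\<open>52 / 115\<close> is \<open>13 / 5\<close> divided by
        \<open>23 / 4\<close>; it lies below \<open>1 / 2 \<le> cos a\<close>.\<close>
      have "13 / 5 * sin A \<le> 23 / 4 * q" unfolding qq using ca c sA
        by (simp add: mult_left_mono[of "52/115" "cos a" "sin A"] field_simps)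
      then show ?thesis using c by (intro mult_right_mono) auto
    qed
    finally show ?thesis using lo unfolding abs_le_iff mult.assoc by linarith
  qed
  show ?thesis
  proof (cases "0 \<le> a")
    case True
    then show ?thesis using main[of a] AB by simp
  next
    case False
    then have "\<bar>cos A * sin (-a) - 4 * q * (-a)\<bar> \<le> 7 / 4 * q * (-a)" using main[of "-a"] AB by simp
    moreover have "cos A * sin (-a) - 4 * q * (-a) = - (cos A * sin a - 4 * q * a)" by simp
    ultimately show ?thesis using False by (simp only: abs_minus_cancel abs_of_neg not_le)
  qed
qed

text \<open>The complements \<open>x\<close> and \<open>y\<close> of the two angles sum to
  \<open>pi / 4\<close>, so one of them is at most \<open>pi / 8\<close> and \<open>q\<close> is at
  least \<open>(cos (pi / 8))\<^sup>2\<close>. The balance also gives \<open>x \<le> pi / 6\<close>,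
  so \<open>cos A \<le> 1 / 2\<close>. The factor \<open>2 - sqrt 2\<close> is the quotient of these
  two bounds.\<close>

lemma trig_three_eighths:
  fixes A B a b q :: real
  assumes AB: "A + B = 3 * pi / 4" "\<bar>a\<bar> < pi / 2 - A" "\<bar>b\<bar> < pi / 2 - B"
    and q: "q = sin A * cos a" "q = sin B * cos b"
  shows "\<bar>cos A * sin a\<bar> \<le> (2 - sqrt 2) * q * \<bar>a\<bar>"
proof -
  define x y where "x = pi / 2 - A" and "y = pi / 2 - B"
  have xy: "x + y = pi / 4" "\<bar>a\<bar> < x" "\<bar>b\<bar> < y" using AB by (auto simp: x_def y_def)
  have pos: "0 < x" "0 < y" using xy by auto
  have sA: "sin A = cos x" "cos A = sin x" "sin B = cos y"
    unfolding x_def y_def using sin_cos_eq[of A] cos_sin_eq[of A] sin_cos_eq[of B] by simp_all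
  have cx: "0 < cos x" "0 < cos y" using xy pos by (auto intro!: cos_gt_zero)
  have "cos x \<le> cos \<bar>a\<bar>" using xy pos by (intro cos_monotone_0_pi_le) auto
  then have qx: "(cos x)\<^sup>2 \<le> q" using cx q sA by (simp add: power2_eq_square)
  have "cos y \<le> cos \<bar>b\<bar>" using xy pos by (intro cos_monotone_0_pi_le) auto
  then have "cos y * cos y \<le> cos y * cos b" using cx by (intro mult_left_mono) auto
  then have qy: "(cos y)\<^sup>2 \<le> q" using q sA by (simp add: power2_eq_square)
  have sq: "(cos t)\<^sup>2 = (1 + cos (2 * t)) / 2" for t :: real by (simp add: cos_double_cos)
  have "x \<le> pi / 6"
  proof (rule ccontr)
    \<comment> \<open>Then \<open>y < pi / 12\<close>, so \<open>q \<ge> (cos y)\<^sup>2\<close>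
      would exceed \<open>(cos (pi / 12))\<^sup>2\<close>, although
      \<open>q \<le> cos x < cos (pi / 6)\<close>.\<close>
    assume n: "\<not> x \<le> pi / 6"
    have "cos (pi / 6) < cos (2 * y)" using n xy pos by (intro cos_monotone_0_pi) auto
    moreover have "cos x < cos (pi / 6)" using n xy pos by (intro cos_monotone_0_pi) auto
    moreover have "q \<le> cos x" using q sA cx by (simp add: mult_left_le)
    ultimately have "(1 + sqrt 3 / 2) / 2 < sqrt 3 / 2" using qy sq[of y] by (simp add: cos_30)
    then have "2 < sqrt 3" by simp
    then have "2\<^sup>2 < (sqrt 3)\<^sup>2" by (intro power_strict_mono) auto
    then show False by simp
  qed
  then have sx: "sin x \<le> 1 / 2" "0 < sin x"
    using sin_monotone_2pi_le[of x "pi / 6"] pos xy by (auto simp: sin_30 intro!: sin_gt_zero)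
  have "(1 + sqrt 2 / 2) / 2 \<le> q"
  proof (cases "x \<le> pi / 8")
    case True
    then have "cos (pi / 4) \<le> cos (2 * x)" using pos by (intro cos_monotone_0_pi_le) auto
    then show ?thesis using qx sq[of x] by (simp add: cos_45)
  next
    case False
    then have "cos (pi / 4) \<le> cos (2 * y)" using xy pos by (intro cos_monotone_0_pi_le) auto
    then show ?thesis using qy sq[of y] by (simp add: cos_45)
  qed
  moreover have s2: "0 \<le> 2 - sqrt 2" using real_sqrt_le_mono[of 2 4] by simp
  ultimately have "(2 - sqrt 2) * ((1 + sqrt 2 / 2) / 2) \<le> (2 - sqrt 2) * q"
    by (rule mult_left_mono)
  moreover have "(2 - sqrt 2) * ((1 + sqrt 2 / 2) / 2) = 1 / 2" by (simp add: field_simps)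
  ultimately have "1 / 2 \<le> (2 - sqrt 2) * q" by simp
  then have "sin x \<le> (2 - sqrt 2) * q" using sx by simp
  then have "sin x * \<bar>sin a\<bar> \<le> ((2 - sqrt 2) * q) * \<bar>a\<bar>"
    using sx abs_sin_x_le_abs_x[of a] by (intro mult_mono) auto
  then show ?thesis using sA sx by (simp add: abs_mult)
qed

lemma has_vector_derivative_shift:
  assumes "(f has_vector_derivative f') (at (t + c))"
  shows "((\<lambda>t. f (t + c)) has_vector_derivative f') (at (t::real))"
proof -
  have "((\<lambda>s. s + c) has_vector_derivative 1) (at t)"
    unfolding has_real_derivative_iff_has_vector_derivative[symmetric]
    by (auto intro!: derivative_eq_intros)
  from vector_diff_chain_at[OF this assms] show ?thesis by (simp add: o_def)
qed

text \<open>At a maximum point of \<open>norm \<circ> u\<close> the increment of \<open>u\<close> over one period would have to be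
  larger than the mean value inequality allows.\<close>

lemma quasi_periodic_zero:
  fixes u u' :: "real \<Rightarrow> complex"
  assumes T: "0 < T"
    and der: "\<And>t. (u has_vector_derivative u' t) (at t)"
    and bd: "\<And>t. norm (u' t) \<le> \<epsilon> * \<omega> t * norm (u t)"
    and \<omega>: "\<And>t. 0 \<le> \<omega> t" and \<epsilon>: "0 \<le> \<epsilon>"
    and F: "\<And>t. \<exists>F. (\<forall>s\<in>{t..t+T}. (F has_real_derivative \<omega> s) (at s)) \<and> F (t + T) - F t = \<Delta>"
    and per: "\<And>t. u (t + T) = k * u t"
    and k: "norm k = 1" "\<epsilon> * \<Delta> < norm (k - 1)"
  shows "u t = 0"
proof -
  have cont: "continuous_on S u" for S
    using der by (intro continuous_at_imp_continuous_on) (auto intro: has_vector_derivative_continuous)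
  have pern: "norm (u (t + T)) = norm (u t)" for t using per k by (simp add: norm_mult)
  \<comment> \<open>The norm of \<open>u\<close> is \<open>T\<close>-periodic, so a maximum over one
    period is a global one.\<close>
  have pern': "norm (u (t + of_int n * T)) = norm (u t)" for t n
  proof (induction n rule: int_induct[where k = 0])
    case (step1 i)
    then show ?case using pern[of "t + of_int i * T"] by (simp add: algebra_simps)
  next
    case (step2 i)
    then show ?case using pern[of "t + of_int (i - 1) * T"] by (simp add: algebra_simps)
  qed auto
  obtain m where m: "\<And>s. s \<in> {0..T} \<Longrightarrow> norm (u s) \<le> norm (u m)"
    using continuous_attains_sup[of "{0..T}" "\<lambda>s. norm (u s)"] T cont[of "{0..T}"]
    by (fastforce intro!: continuous_on_norm)
  have max: "norm (u s) \<le> norm (u m)" for s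
  proof -
    have "norm (u s) = norm (u (s + of_int (- \<lfloor>s / T\<rfloor>) * T))" by (simp only: pern')
    also have "\<dots> \<le> norm (u m)"
    proof (rule m)
      have "of_int \<lfloor>s / T\<rfloor> \<le> s / T" "s / T \<le> of_int \<lfloor>s / T\<rfloor> + 1" by linarith+
      then have "of_int \<lfloor>s / T\<rfloor> * T \<le> s" "s \<le> (of_int \<lfloor>s / T\<rfloor> + 1) * T"
        using T by (simp_all only: pos_le_divide_eq pos_divide_le_eq)
      then show "s + of_int (- \<lfloor>s / T\<rfloor>) * T \<in> {0..T}" by (simp add: algebra_simps)
    qed
    finally show ?thesis .
  qed
  obtain F where F': "\<And>s. s \<in> {m..m+T} \<Longrightarrow> (F has_real_derivative \<omega> s) (at s)"
    and \<Delta>: "F (m + T) - F m = \<Delta>" using F[of m] by blast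
  \<comment> \<open>Over the period starting at the maximum point, the speed of \<open>u\<close> is
    at most \<open>\<epsilon> * norm (u m) * \<omega>\<close>, which \<open>F\<close> integrates.
    The left side is \<open>norm (k - 1) * norm (u m)\<close>, so \<open>u m\<close> must
    vanish.\<close>
  have "norm (u (m + T) - u m) \<le> \<epsilon> * norm (u m) * F (m + T) - \<epsilon> * norm (u m) * F m"
  proof (rule differentiable_bound_general)
    show "m < m + T" using T by simp
    show "continuous_on {m..m+T} u" by (rule cont)
    show "continuous_on {m..m+T} (\<lambda>s. \<epsilon> * norm (u m) * F s)"
      using F' by (intro continuous_intros continuous_at_imp_continuous_on) (meson DERIV_isCont)
    show "(u has_vector_derivative u' s) (at s)" for s by (rule der)
    show "((\<lambda>s. \<epsilon> * norm (u m) * F s) has_vector_derivative \<epsilon> * norm (u m) * \<omega> s) (at s)"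
      if "m < s" "s < m + T" for s
      using F'[of s] that
      by (auto simp: has_real_derivative_iff_has_vector_derivative[symmetric] intro!: DERIV_cmult)
    show "norm (u' s) \<le> \<epsilon> * norm (u m) * \<omega> s" for s
    proof -
      have "norm (u' s) \<le> \<epsilon> * \<omega> s * norm (u s)" by (rule bd)
      also have "\<dots> \<le> \<epsilon> * \<omega> s * norm (u m)" using max[of s] \<omega>[of s] \<epsilon> by (intro mult_left_mono) auto
      finally show ?thesis by (simp add: algebra_simps)
    qed
  qed
  then have "norm ((k - 1) * u m) \<le> \<epsilon> * norm (u m) * \<Delta>"
    using per[of m] by (simp add: left_diff_distrib right_diff_distrib flip: \<Delta>)
  then have "norm (k - 1) * norm (u m) \<le> \<epsilon> * \<Delta> * norm (u m)"
    unfolding norm_mult by (simp add: mult_ac)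
  then have "norm (u m) = 0" using k(2) by (auto simp: mult_le_cancel_right)
  then show ?thesis using max[of t] by simp
qed

subsection \<open>Ovals with chords of constant length\<close>

text \<open>The normal form of the body: center at 0, plane identified with the complex numbers.
  \<open>left\<close> keeps the curve strictly to the left of each tangent line, which encodes
  strict convexity together with the counterclockwise orientation.\<close>

locale equichordal_oval =
  fixes g v :: "real \<Rightarrow> complex" and P d \<sigma> :: real
  assumes P: "0 < P"
    and g_deriv: "(g has_vector_derivative v t) (at t)"
    and v_cont: "continuous_on UNIV v"
    and v_unit: "norm (v t) = 1"
    and antipode: "g (t + P / 2) = - g t"
    and left: "0 < \<tau> \<Longrightarrow> \<tau> < P \<Longrightarrow> 0 < Im (cnj (v t) * (g (t + \<tau>) - g t))"
    and \<sigma>: "0 < \<sigma>" "\<sigma> < 1 / 2"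
    and chord: "norm (g (t + \<sigma> * P) - g t) = d"
begin

definition T :: real where "T = \<sigma> * P"

lemma T_bounds: "0 < T" "T < P / 2"
proof -
  show "0 < T" using \<sigma> P by (simp add: T_def)
  show "T < P / 2" unfolding T_def using mult_strict_right_mono[OF \<sigma>(2) P] by simp
qed

lemma v_antipode: "v (t + P / 2) = - v t"
proof -
  have "((\<lambda>t. g (t + P / 2)) has_vector_derivative v (t + P / 2)) (at t)"
    by (intro has_vector_derivative_shift g_deriv)
  moreover have "((\<lambda>t. g (t + P / 2)) has_vector_derivative - v t) (at t)"
    unfolding antipode by (intro has_vector_derivative_minus g_deriv)
  ultimately show ?thesis by (rule vector_derivative_unique_at)
qed

lemma g_period: "g (t + P) = g t"
  using antipode[of t] antipode[of "t + P / 2"] by (simp add: add.assoc)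

text \<open>If the tangents at both ends agreed, the chord would have to point to the left of their
  common direction when traversed either way.\<close>

lemma v_inj: "0 < \<tau> \<Longrightarrow> \<tau> < P \<Longrightarrow> v (t + \<tau>) \<noteq> v t"
  using left[of \<tau> t] left[of "P - \<tau>" "t + \<tau>"] g_period[of t]
  by (auto simp: algebra_simps)

text \<open>A zero of \<open>?f\<close> in the open half period would make \<open>v (t + s)\<close>
  equal to \<open>v t\<close> or to \<open>v (t + P / 2)\<close>, against \<open>v_inj\<close>;
  hence the sign is constant. It is positive somewhere, because \<open>?f\<close> is the derivative
  of the height above the tangent line at \<open>g t\<close>.\<close>

lemma v_turns_left:
  assumes "0 < \<tau>" "\<tau> < P / 2"
  shows "0 < Im (cnj (v t) * v (t + \<tau>))"
proof (rule ccontr)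
  let ?f = "\<lambda>s. Im (cnj (v t) * v (t + s))"
  assume neg: "\<not> 0 < ?f \<tau>"
  have nz: "?f s \<noteq> 0" if s: "0 < s" "s < P / 2" for s
  proof
    define z where "z = cnj (v t) * v (t + s)"
    assume "?f s = 0"
    moreover have "norm z = 1" using v_unit by (simp add: z_def norm_mult)
    ultimately have "z = 1 \<or> z = -1"
      by (auto simp: z_def[symmetric] cmod_def complex_eq_iff abs_if split: if_splits)
    moreover have "v (t + s) = v t * z"
      using v_unit[of t] complex_norm_square[of "v t"] by (simp add: z_def flip: mult.assoc)
    ultimately have "v (t + s) = v t \<or> v (t + s) = v (t + P / 2)"
      using v_antipode[of t] by auto
    then show False
      using v_inj[of s t] v_inj[of "P / 2 - s" "t + s"] s by auto
  qed
  have cont: "continuous_on S ?f" for S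
    by (intro continuous_intros continuous_on_compose2[OF v_cont]) auto
  have der: "((\<lambda>s. Im (cnj (v t) * (g (t + s) - g t))) has_real_derivative ?f s) (at s)" for s
  proof -
    have "((\<lambda>s. g (t + s)) has_vector_derivative v (t + s)) (at s)"
      using has_vector_derivative_shift[of g "v (t + s)" s t] g_deriv by (simp add: add.commute)
    then have "((\<lambda>s. cnj (v t) * (g (t + s) - g t)) has_vector_derivative cnj (v t) * v (t + s)) (at s)"
      by (auto intro!: derivative_eq_intros)
    from bounded_linear.has_vector_derivative[OF bounded_linear_Im this] show ?thesis
      by (simp add: has_real_derivative_iff_has_vector_derivative)
  qed
  obtain z where z: "0 < z" "z < \<tau>"
    "Im (cnj (v t) * (g (t + \<tau>) - g t)) - Im (cnj (v t) * (g (t + 0) - g t)) = (\<tau> - 0) * ?f z"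
    using MVT2[OF assms(1) der] by blast
  then have "0 < ?f z" using left[of \<tau> t] assms P by (simp add: zero_less_mult_iff)
  with neg z obtain x where "z \<le> x" "x \<le> \<tau>" "?f x = 0"
    using IVT2'[of ?f \<tau> 0 z] cont by auto
  then show False using nz z assms by auto
qed

section \<open>Chord directions and the angles between chords and tangents\<close>

definition e :: "real \<Rightarrow> complex" where "e t = (g (t + T) - g t) / d"

text \<open>Since the chord points to the left of the tangent, the oriented angle lies between 0 and
  \<open>pi\<close> and \<open>arccos\<close> recovers it.\<close>

definition \<delta> :: "real \<Rightarrow> real" where "\<delta> t = arccos (Re (e t * cnj (v t)))"

lemma d_pos: "0 < d"
  using left[of T 0] T_bounds P chord[of 0] by (auto simp: T_def)

lemma e_unit: "norm (e t) = 1"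
  using chord[of t] d_pos by (simp add: e_def T_def norm_divide)

lemma e_deriv_raw: "(e has_vector_derivative (v (t + T) - v t) / d) (at t)"
proof -
  have "((\<lambda>s. g (s + T)) has_vector_derivative v (t + T)) (at t)"
    by (intro has_vector_derivative_shift g_deriv)
  then show ?thesis unfolding e_def using g_deriv
    by (auto intro!: derivative_eq_intros)
qed

text \<open>The rotations \<open>p\<close>, from the first tangent to the chord, and
  \<open>q\<close>, from the chord to the second tangent, both have positive imaginary part.
  Constancy of the chord length equates their real parts, so they coincide. From \<open>t\<close> to
  \<open>t + T\<close>, less than half the perimeter, the tangent thus turns by
  \<open>2 * \<delta> t\<close>; \<open>v_turns_left\<close> keeps this below
  \<open>pi\<close>.\<close>

lemma tangents:
  shows e_eq: "e t = v t * cis (\<delta> t)"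
    and v_shift: "v (t + T) = e t * cis (\<delta> t)"
    and \<delta>_bounds: "0 < \<delta> t" "\<delta> t < pi / 2"
proof -
  define p where "p = e t * cnj (v t)"
  define q where "q = v (t + T) * cnj (e t)"
  have vv: "v s * cnj (v s) = 1" for s using v_unit complex_norm_square[of "v s"] by simp
  have ee: "e s * cnj (e s) = 1" for s using e_unit complex_norm_square[of "e s"] by simp
  have np: "norm p = 1" "norm q = 1" using v_unit e_unit by (auto simp: p_def q_def norm_mult)
  have "0 < Im (cnj (v t) * (g (t + T) - g t)) / d"
    using left[of T t] T_bounds P d_pos by auto
  also have "\<dots> = Im p" by (simp add: p_def e_def mult.commute)
  finally have Ip: "0 < Im p" .
  \<comment> \<open>Going on by \<open>P - T\<close> from \<open>g (t + T)\<close> leads back to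
    \<open>g t\<close>, so this is the same chord reversed.\<close>
  have "0 < Im (cnj (v (t + T)) * (g (t + T + (P - T)) - g (t + T)))"
    using left[of "P - T" "t + T"] T_bounds P by auto
  also have "g (t + T + (P - T)) - g (t + T) = - (of_real d * e t)"
    using g_period[of t] d_pos by (simp add: e_def)
  also have "Im (cnj (v (t + T)) * - (of_real d * e t)) = d * Im q"
    by (simp add: q_def algebra_simps)
  finally have "0 < d * Im q" .
  then have Iq: "0 < Im q" using d_pos by (simp add: zero_less_mult_iff)
  have Rpq: "Re p = Re q"
  proof -
    define D where "D = (v (t + T) - v t) / d"
    have "((\<lambda>s. Re (e s * cnj (e s))) has_real_derivative Re (e t * cnj D + D * cnj (e t))) (at t)"
      using bounded_linear.has_vector_derivative[OF bounded_linear_Re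
          has_vector_derivative_mult[OF e_deriv_raw
            bounded_linear.has_vector_derivative[OF bounded_linear_cnj e_deriv_raw]]]
      by (simp only: has_real_derivative_iff_has_vector_derivative D_def)
    then have "((\<lambda>s. 1) has_real_derivative Re (e t * cnj D + D * cnj (e t))) (at t)"
      by (simp only: ee one_complex.simps)
    then have "Re (e t * cnj D + D * cnj (e t)) = 0" by (rule DERIV_unique) simp
    then have "Re (D * cnj (e t)) = 0" by simp
    also have "D * cnj (e t) = (v (t + T) * cnj (e t) - v t * cnj (e t)) / d"
      by (simp only: D_def times_divide_eq_left left_diff_distrib)
    also have "\<dots> = (q - cnj p) / d"
      unfolding p_def q_def complex_cnj_mult complex_cnj_cnj by (simp only: mult.commute)
    also have "Re \<dots> = (Re q - Re p) / d" by simp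
    finally have "(Re q - Re p) / d = 0" .
    then show ?thesis using d_pos by simp
  qed
  have p: "p = cis (\<delta> t)" "0 < \<delta> t" "\<delta> t < pi"
    unfolding \<delta>_def p_def[symmetric] by (rule unit_eq_cis_arccos[OF np(1) Ip])+
  have q: "q = cis (\<delta> t)"
    unfolding \<delta>_def p_def[symmetric] Rpq by (rule unit_eq_cis_arccos[OF np(2) Iq])
  show 1: "e t = v t * cis (\<delta> t)"
    using vv[of t] unfolding p(1)[symmetric] p_def by (simp add: algebra_simps)
  show 2: "v (t + T) = e t * cis (\<delta> t)"
    using ee[of t] unfolding q[symmetric] q_def by (simp add: algebra_simps)
  have "cnj (v t) * v (t + T) = (v t * cnj (v t)) * (cis (\<delta> t) * cis (\<delta> t))"
    unfolding 2 1 by (simp only: mult_ac)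
  also have "\<dots> = cis (2 * \<delta> t)" unfolding vv by (simp add: cis_mult)
  finally have "0 < sin (2 * \<delta> t)" using v_turns_left[of T t] T_bounds by simp
  then have "0 < cos (\<delta> t)" using sin_gt_zero[OF p(2,3)] by (simp add: sin_double zero_less_mult_iff)
  then show "\<delta> t < pi / 2" using p cos_monotone_0_pi_le[of "pi / 2" "\<delta> t"] by (auto simp: not_less[symmetric])
  show "0 < \<delta> t" by (rule p)
qed

definition w :: "real \<Rightarrow> real" where "w t = 2 * sin (\<delta> t) / d"

lemma w_pos: "0 < w t"
  using sin_gt_zero[of "\<delta> t"] \<delta>_bounds[of t] d_pos by (simp add: w_def)

lemma e_deriv: "(e has_vector_derivative \<i> * w t * e t) (at t)"
proof -
  have "v t = e t * cis (- \<delta> t)" unfolding e_eq by (simp add: cis_mult mult.assoc)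
  then have "v (t + T) - v t = e t * (2 * \<i> * sin (\<delta> t))"
    unfolding v_shift by (simp add: complex_eq_iff algebra_simps)
  then show ?thesis using e_deriv_raw[of t] by (simp add: w_def mult_ac)
qed

lemma v_v_shift: "v (t + T) = v t * cis (2 * \<delta> t)"
  unfolding v_shift unfolding e_eq by (simp add: cis_mult mult.assoc)

lemma e_shift: "e (t + T) = e t * cis (\<delta> t + \<delta> (t + T))"
  unfolding e_eq[of "t + T"] v_shift by (simp add: cis_mult mult.assoc)

lemma \<delta>_sum_deriv:
  "((\<lambda>t. \<delta> t + \<delta> (t + T)) has_real_derivative w (t + T) - w t) (at t)"
proof -
  let ?S = "\<lambda>t. \<delta> t + \<delta> (t + T)"
  have ee: "e s * cnj (e s) = 1" for s using e_unit complex_norm_square[of "e s"] by simp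
  have q: "e (s + T) * cnj (e s) = cis (?S s)" for s
    using ee[of s] unfolding e_shift by (simp add: algebra_simps)
  have S: "0 < ?S s" "?S s < pi" for s using \<delta>_bounds[of s] \<delta>_bounds[of "s + T"] by auto
  have eq: "?S = (\<lambda>s. arccos (Re (e (s + T) * cnj (e s))))"
    unfolding q using S by (auto simp: arccos_cos less_imp_le)
  have "((\<lambda>s. e (s + T) * cnj (e s)) has_vector_derivative
      e (t + T) * cnj (\<i> * w t * e t) + \<i> * w (t + T) * e (t + T) * cnj (e t)) (at t)"
    by (intro has_vector_derivative_mult has_vector_derivative_shift e_deriv
        bounded_linear.has_vector_derivative[OF bounded_linear_cnj])
  also have "e (t + T) * cnj (\<i> * w t * e t) + \<i> * w (t + T) * e (t + T) * cnj (e t)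
      = \<i> * of_real (w (t + T) - w t) * (e (t + T) * cnj (e t))" by (simp add: algebra_simps)
  also have "\<dots> = \<i> * of_real (w (t + T) - w t) * cis (?S t)" by (simp only: q)
  finally have "((\<lambda>s. Re (e (s + T) * cnj (e s))) has_real_derivative
      - ((w (t + T) - w t) * sin (?S t))) (at t)"
    using bounded_linear.has_vector_derivative[OF bounded_linear_Re]
    by (fastforce simp: has_real_derivative_iff_has_vector_derivative)
  moreover have "-1 < Re (e (t + T) * cnj (e t))" "Re (e (t + T) * cnj (e t)) < 1"
    unfolding q using cos_monotone_0_pi[of "?S t" pi] cos_monotone_0_pi[of 0 "?S t"] S[of t]
    by (auto simp: less_imp_le)
  ultimately have "((\<lambda>s. arccos (Re (e (s + T) * cnj (e s)))) has_real_derivative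
      inverse (- sqrt (1 - (Re (e (t + T) * cnj (e t)))\<^sup>2)) * - ((w (t + T) - w t) * sin (?S t))) (at t)"
    by (intro DERIV_chain2[OF DERIV_arccos])
  also have "Re (e (t + T) * cnj (e t)) = cos (?S t)" unfolding q by simp
  moreover have s0: "0 < sin (?S t)" using S by (intro sin_gt_zero) auto
  moreover have "sqrt (1 - (cos (?S t))\<^sup>2) = sin (?S t)" using s0
    by (intro real_sqrt_unique) (auto simp: sin_squared_eq)
  ultimately show ?thesis unfolding eq[symmetric] by (auto elim!: DERIV_cong)
qed

text \<open>Relative to the tangent at \<open>g (t + T)\<close>, the chords starting in \<open>{t..t+T}\<close> make an angle less than
  \<open>\<pi> / 2\<close>, so this angle is given by \<open>arcsin\<close> on the whole interval.\<close>

lemma w_antiderivative: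
  "\<exists>F. (\<forall>s\<in>{t..t+T}. (F has_real_derivative w s) (at s)) \<and> F (t + T) - F t = \<delta> t + \<delta> (t + T)"
proof -
  define m where "m = v (t + T)"
  define f where "f s = e s * cnj m" for s
  have mm: "m * cnj m = 1" using v_unit complex_norm_square[of m] by (simp add: m_def)
  have vv: "v s * cnj (v s) = 1" for s using v_unit complex_norm_square[of "v s"] by simp
  have fd: "(f has_vector_derivative \<i> * w s * f s) (at s)" for s
    using has_vector_derivative_mult_left[OF e_deriv[of s], of "cnj m"]
    by (simp add: f_def[abs_def] mult_ac)
  have fn: "norm (f s) = 1" for s using e_unit v_unit by (simp add: f_def m_def norm_mult)
  have f0: "f t = cis (- \<delta> t)"
  proof -
    have "e t = m * cis (- \<delta> t)" unfolding m_def v_shift by (simp add: cis_mult mult.assoc)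
    then show ?thesis using mm by (simp add: f_def algebra_simps)
  qed
  have f1: "f (t + T) = cis (\<delta> (t + T))"
    using mm unfolding f_def e_eq[of "t + T"] m_def by (simp add: algebra_simps)
  have pos: "0 < Re (f s)" if s: "s \<in> {t..t+T}" for s
  proof (cases "s = t \<or> s = t + T")
    case True
    then show ?thesis using f0 f1 \<delta>_bounds[of s] by (auto intro!: cos_gt_zero_pi)
  next
    case False
    then have s': "t < s" "s < t + T" using s by auto
    \<comment> \<open>The tangent turns by \<open>a\<close> from \<open>s\<close> to
      \<open>t + T\<close> and by \<open>b\<close> from \<open>t + T\<close> to
      \<open>s + T\<close>, both less than \<open>pi\<close>. As
      \<open>a + b = 2 * \<delta> s\<close>, the angle of \<open>f s\<close> is
      \<open>(b - a) / 2\<close>, of absolute value below \<open>pi / 2\<close>.\<close>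
    define x where "x = m * cnj (v s)"
    define y where "y = v (s + T) * cnj m"
    have x: "norm x = 1" "0 < Im x"
      using v_turns_left[of "t + T - s" s] s' T_bounds v_unit
      by (auto simp: x_def m_def norm_mult mult.commute)
    have y: "norm y = 1" "0 < Im y"
      using v_turns_left[of "s - t" "t + T"] s' T_bounds v_unit
      by (auto simp: y_def m_def norm_mult mult.commute algebra_simps)
    define a where "a = arccos (Re x)"
    define b where "b = arccos (Re y)"
    have a: "x = cis a" "0 < a" "a < pi" using unit_eq_cis_arccos[OF x] by (auto simp: a_def)
    have b: "y = cis b" "0 < b" "b < pi" using unit_eq_cis_arccos[OF y] by (auto simp: b_def)
    have "cis (a + b) = (m * cnj m) * (v (s + T) * cnj (v s))"
      by (simp add: a(1)[symmetric] b(1)[symmetric] x_def y_def flip: cis_mult)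
    also have "\<dots> = cis (2 * \<delta> s)" using vv[of s] mm unfolding v_v_shift by (simp add: algebra_simps)
    finally have "cis (a + b) = cis (2 * \<delta> s)" .
    then have "cos (a + b) = cos (2 * \<delta> s)" "sin (a + b) = sin (2 * \<delta> s)"
      by (auto simp: complex_eq_iff)
    then have c1: "cos (a + b - 2 * \<delta> s) = 1"
      using sin_cos_squared_add3[of "a + b"] by (simp add: cos_diff)
    have "\<bar>a + b - 2 * \<delta> s\<bar> < 2 * pi" using a b \<delta>_bounds[of s] by (auto simp: abs_less_iff)
    then have ab: "a + b = 2 * \<delta> s" using cos_eq_1_imp_zero[OF c1] by simp
    have "f s = (v s * cnj m) * cis (\<delta> s)" by (simp add: f_def e_eq mult_ac)
    also have "v s * cnj m = cnj x" by (simp add: x_def)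
    finally have "f s = cis (\<delta> s - a)" by (simp add: a cis_cnj cis_mult add.commute)
    moreover have "- (pi / 2) < \<delta> s - a" "\<delta> s - a < pi / 2" using ab a(2,3) b(2,3) by linarith+
    ultimately show ?thesis using cos_gt_zero_pi by simp
  qed
  have "((\<lambda>s. arcsin (Im (f s))) has_real_derivative w s) (at s)" if "s \<in> {t..t+T}" for s
  proof -
    have r: "(Re (f s))\<^sup>2 + (Im (f s))\<^sup>2 = 1" using fn[of s] cmod_power2[of "f s"] by simp
    have p: "0 < Re (f s)" using pos that by blast
    then have "(Im (f s))\<^sup>2 < 1" using r zero_less_power[OF p, of 2] by linarith
    then have i: "-1 < Im (f s)" "Im (f s) < 1" by (auto simp: power2_less_1_iff abs_less_iff)
    have sq: "sqrt (1 - (Im (f s))\<^sup>2) = Re (f s)"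
      using r p by (intro real_sqrt_unique) auto
    have "((\<lambda>s. Im (f s)) has_real_derivative w s * Re (f s)) (at s)"
      using bounded_linear.has_vector_derivative[OF bounded_linear_Im fd[of s]]
      by (simp add: has_real_derivative_iff_has_vector_derivative)
    from DERIV_chain2[OF DERIV_arcsin[OF i] this] show ?thesis
      unfolding sq by (rule DERIV_cong) (use p in simp)
  qed
  moreover have "arcsin (Im (f (t + T))) - arcsin (Im (f t)) = \<delta> t + \<delta> (t + T)"
    unfolding f0 f1 using \<delta>_bounds[of t] \<delta>_bounds[of "t + T"]
    by (simp add: arcsin_minus arcsin_sin flip: sin_minus)
  ultimately show ?thesis by blast
qed

lemma \<delta>_rotation: "v (t + 4 * T) = v t * cis (2 * (\<delta> t + \<delta> (t + T) + \<delta> (t + 2 * T) + \<delta> (t + 3 * T)))"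
proof -
  have eq: "t + T + T = t + 2 * T" "t + 2 * T + T = t + 3 * T" "t + 3 * T + T = t + 4 * T" by auto
  have "v (t + T + T + T + T) = v t * (cis (2 * \<delta> t) * cis (2 * \<delta> (t + T)) * cis (2 * \<delta> (t + T + T))
      * cis (2 * \<delta> (t + T + T + T)))"
    unfolding v_v_shift by (simp only: mult.assoc)
  then show ?thesis unfolding eq by (simp add: cis_mult algebra_simps)
qed

end

subsection \<open>Density one eighth or three eighths\<close>

locale eighth_oval = equichordal_oval +
  assumes \<sigma>_cases: "\<sigma> = 1 / 8 \<or> \<sigma> = 3 / 8"
begin

text \<open>For both densities \<open>4 * T\<close> is an odd multiple of the half perimeter, namely
  \<open>P / 2\<close> or \<open>P + P / 2\<close>.\<close>

lemma four_shifts: "g (t + 4 * T) = - g t" "v (t + 4 * T) = - v t" "\<delta> (t + 4 * T) = \<delta> t"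
  "e (t + 4 * T) = - e t"
proof -
  have v2: "v (t + P) = v t" for t
    using v_antipode[of t] v_antipode[of "t + P / 2"] by (simp add: add.assoc)
  have 4: "4 * T = P / 2 \<or> 4 * T = P + P / 2" using \<sigma>_cases by (auto simp: T_def)
  then have "t + 4 * T = t + P / 2 \<or> t + 4 * T = t + P + P / 2" for t by auto
  then show g4: "g (t + 4 * T) = - g t" and v4: "v (t + 4 * T) = - v t" for t
    by (metis antipode g_period, metis v_antipode v2)
  have "e (t + 4 * T) = - e t"
    using g4[of t] g4[of "t + T"] by (simp add: e_def algebra_simps add_divide_distrib diff_divide_distrib)
  then show "e (t + 4 * T) = - e t" "\<delta> (t + 4 * T) = \<delta> t"
    using v4[of t] by (simp_all add: \<delta>_def)
qed

text \<open>The reversal of the tangent after \<open>4 * T\<close> only gives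
  \<open>cis (2 * s) = -1\<close>, so \<open>s\<close> is \<open>pi / 2\<close> or
  \<open>3 * pi / 2\<close>. The turn over \<open>2 * T\<close> decides: this arc is a quarter of
  the perimeter for 1/8 and three quarters for 3/8, so each pair of consecutive angles sums to less,
  respectively more, than \<open>pi / 2\<close>.\<close>

lemma \<delta>_sum: "\<delta> t + \<delta> (t + T) + \<delta> (t + 2 * T) + \<delta> (t + 3 * T) = 4 * \<sigma> * pi"
proof -
  define s where "s = \<delta> t + \<delta> (t + T) + \<delta> (t + 2 * T) + \<delta> (t + 3 * T)"
  have "v t \<noteq> 0" using v_unit[of t] by auto
  moreover have "v t * -1 = v t * cis (2 * s)"
    using \<delta>_rotation[of t] unfolding four_shifts s_def[symmetric] by simp
  ultimately have c: "cis (2 * s) = -1" by (metis mult_cancel_left)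
  have sum_bounds: "0 < \<delta> t + \<delta> (t + T)" "\<delta> t + \<delta> (t + T) < pi" for t
    using \<delta>_bounds[of t] \<delta>_bounds[of "t + T"] by auto
  have im: "Im (cnj (v t) * v (t + 2 * T)) = sin (2 * (\<delta> t + \<delta> (t + T)))" for t
  proof -
    have vv: "v t * cnj (v t) = 1" using v_unit complex_norm_square[of "v t"] by simp
    have "v (t + T + T) = v t * cis (2 * (\<delta> t + \<delta> (t + T)))"
      unfolding v_v_shift by (simp add: cis_mult mult.assoc algebra_simps)
    then have "cnj (v t) * v (t + T + T) = (v t * cnj (v t)) * cis (2 * (\<delta> t + \<delta> (t + T)))"
      by (simp only: mult_ac)
    moreover have "t + T + T = t + 2 * T" by simp
    ultimately show ?thesis unfolding vv by simp
  qed
  have pair1: "\<delta> t + \<delta> (t + T) < pi / 2" if "\<sigma> = 1 / 8" for t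
  proof -
    have "2 * T < P / 2" using that P by (simp add: T_def)
    then have "0 < Im (cnj (v t) * v (t + 2 * T))" using T_bounds by (intro v_turns_left) auto
    moreover have "2 * (\<delta> t + \<delta> (t + T)) < 2 * pi" using sum_bounds[of t] by simp
    ultimately have "\<not> pi \<le> 2 * (\<delta> t + \<delta> (t + T))" unfolding im by (meson sin_le_zero not_le)
    then show ?thesis unfolding distrib_left by linarith
  qed
  have pair3: "pi / 2 < \<delta> t + \<delta> (t + T)" if "\<sigma> = 3 / 8" for t
  proof -
    have "t + 2 * T = t + P / 4 + P / 2" using that by (simp add: T_def)
    then have "v (t + 2 * T) = - v (t + P / 4)" by (simp only: v_antipode)
    then have "Im (cnj (v t) * v (t + 2 * T)) < 0" using v_turns_left[of "P / 4" t] P by simp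
    moreover have "0 \<le> 2 * (\<delta> t + \<delta> (t + T))" using sum_bounds[of t] by simp
    ultimately have "\<not> 2 * (\<delta> t + \<delta> (t + T)) \<le> pi" unfolding im by (meson sin_ge_zero not_le)
    then show ?thesis unfolding distrib_left by linarith
  qed
  have e: "t + 2 * T + T = t + 3 * T" by simp
  have s: "0 < s" "s < 2 * pi"
    using \<delta>_bounds[of t] \<delta>_bounds[of "t + T"] \<delta>_bounds[of "t + 2 * T"] \<delta>_bounds[of "t + 3 * T"]
    by (auto simp: s_def)
  have "s = 4 * \<sigma> * pi"
  proof (cases "\<sigma> = 1 / 8")
    case True
    have "s < pi" using pair1[OF True, of t] pair1[OF True, of "t + 2 * T"] unfolding s_def e by linarith
    moreover have "cos (2 * s - pi) = 1" using c by (simp add: complex_eq_iff cos_diff)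
    ultimately have "2 * s - pi = 0" using s(1) by (intro cos_eq_1_imp_zero) (auto simp: abs_less_iff)
    moreover have "4 * \<sigma> * pi = pi / 2" using True by simp
    ultimately show ?thesis by linarith
  next
    case False
    then have \<sigma>3: "\<sigma> = 3 / 8" using \<sigma>_cases by auto
    have "pi < s" using pair3[OF \<sigma>3, of t] pair3[OF \<sigma>3, of "t + 2 * T"] unfolding s_def e by linarith
    moreover have "cos (2 * s - 3 * pi) = 1"
      using c cos_periodic[of "2 * s - 3 * pi"] by (simp add: complex_eq_iff cos_diff algebra_simps)
    ultimately have "2 * s - 3 * pi = 0"
      using s(2) by (intro cos_eq_1_imp_zero) (auto simp: abs_less_iff)
    moreover have "4 * \<sigma> * pi = 3 * pi / 2" using \<sigma>3 by simp
    ultimately show ?thesis by linarith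
  qed
  then show ?thesis by (simp only: s_def)
qed

section \<open>The planar system for the half-differences of opposite angles\<close>

definition A :: "real \<Rightarrow> real" where "A t = (\<delta> (t + T) + \<delta> (t + 3 * T)) / 2"
definition B :: "real \<Rightarrow> real" where "B t = (\<delta> t + \<delta> (t + 2 * T)) / 2"
definition a :: "real \<Rightarrow> real" where "a t = (\<delta> (t + T) - \<delta> (t + 3 * T)) / 2"
definition b :: "real \<Rightarrow> real" where "b t = (\<delta> t - \<delta> (t + 2 * T)) / 2"
text \<open>Half of \<open>sin (\<delta> (t + T)) + sin (\<delta> (t + 3 * T))\<close>, and by
  \<open>q_eq\<close> also half of the sum for the other pair.\<close>

definition q :: "real \<Rightarrow> real" where "q t = sin (A t) * cos (a t)"

lemma shift_sums: "t + T + T = t + 2 * T" "t + T + 2 * T = t + 3 * T" "t + T + 3 * T = t + 4 * T"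
  "t + 2 * T + T = t + 3 * T" "t + 3 * T + T = t + 4 * T" "t + 2 * T + 2 * T = t + 4 * T"
  by (auto simp: algebra_simps)

lemma AB_sum: "A t + B t = 4 * \<sigma> * pi / 2"
  using \<delta>_sum[of t] by (simp add: A_def B_def field_simps)

lemma w_balance: "w t + w (t + 2 * T) = w (t + T) + w (t + 3 * T)"
proof -
  have "((\<lambda>t. \<delta> t + \<delta> (t + T) + (\<delta> (t + 2 * T) + \<delta> (t + 2 * T + T))) has_real_derivative
      w (t + T) - w t + (w (t + 2 * T + T) - w (t + 2 * T))) (at t)"
    using DERIV_add[OF \<delta>_sum_deriv[of t] DERIV_shift[THEN iffD1, OF \<delta>_sum_deriv[of "t + 2 * T"]]] by simp
  then have "((\<lambda>t. 4 * \<sigma> * pi) has_real_derivative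
      w (t + T) - w t + (w (t + 3 * T) - w (t + 2 * T))) (at t)"
    unfolding shift_sums using \<delta>_sum by (simp add: add.assoc)
  then have "w (t + T) - w t + (w (t + 3 * T) - w (t + 2 * T)) = 0"
    by (rule DERIV_unique) simp
  then show ?thesis by simp
qed

lemma sin_sums:
  "sin (\<delta> (t + T)) + sin (\<delta> (t + 3 * T)) = 2 * sin (A t) * cos (a t)"
  "sin (\<delta> t) + sin (\<delta> (t + 2 * T)) = 2 * sin (B t) * cos (b t)"
  "sin (\<delta> (t + T)) - sin (\<delta> (t + 3 * T)) = 2 * cos (A t) * sin (a t)"
  "sin (\<delta> t) - sin (\<delta> (t + 2 * T)) = 2 * cos (B t) * sin (b t)"
  by (simp_all only: sin_plus_sin sin_diff_sin A_def B_def a_def b_def mult_ac)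

lemma q_eq: "q t = sin (B t) * cos (b t)"
  using w_balance[of t] d_pos sin_sums(1,2)[of t]
  by (simp add: q_def w_def add_divide_distrib[symmetric] distrib_left[symmetric])

text \<open>The mean angular velocity of the four chords is therefore \<open>2 * q t / d\<close>; it
  serves as the clock in \<open>z_zero\<close>.\<close>

lemma w_sum: "w t + w (t + T) + w (t + 2 * T) + w (t + 3 * T) = 8 * q t / d"
proof -
  have "w t + w (t + T) + w (t + 2 * T) + w (t + 3 * T)
    = 2 * ((sin (\<delta> t) + sin (\<delta> (t + 2 * T))) + (sin (\<delta> (t + T)) + sin (\<delta> (t + 3 * T)))) / d"
    by (simp add: w_def add_divide_distrib algebra_simps)
  also have "\<dots> = 8 * q t / d" unfolding sin_sums using q_eq[of t] by (simp add: q_def)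
  finally show ?thesis .
qed

text \<open>Both half-differences are combinations of the differentiable sums \<open>?S t\<close>
  and \<open>?S (t + T)\<close>; for \<open>a\<close> the constant total of the four angles has to
  be subtracted. The balance of the angular velocities simplifies the derivative of
  \<open>b\<close>.\<close>

lemma ab_deriv:
  "(a has_real_derivative - (2 / d * (cos (B t) * sin (b t)))) (at t)"
  "(b has_real_derivative 2 / d * (cos (A t) * sin (a t))) (at t)"
proof -
  let ?S = "\<lambda>t. \<delta> t + \<delta> (t + T)"
  have S1: "((\<lambda>t. ?S (t + T)) has_real_derivative w (t + 2 * T) - w (t + T)) (at t)"
    using DERIV_shift[THEN iffD1, OF \<delta>_sum_deriv[of "t + T"]] by (simp add: shift_sums)
  have a: "a = (\<lambda>t. (?S t + ?S (t + T) - 4 * \<sigma> * pi) / 2)"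
    proof
    fix s show "a s = (?S s + ?S (s + T) - 4 * \<sigma> * pi) / 2"
      using \<delta>_sum[of s] by (simp add: a_def shift_sums)
  qed
  have b: "b = (\<lambda>t. (?S t - ?S (t + T)) / 2)" by (auto simp: fun_eq_iff b_def shift_sums)
  have "(a has_real_derivative (w (t + T) - w t + (w (t + 2 * T) - w (t + T))) / 2) (at t)"
    unfolding a using DERIV_cdivide[OF DERIV_diff[OF DERIV_add[OF \<delta>_sum_deriv[of t] S1] DERIV_const]]
    by simp
  also have "(w (t + T) - w t + (w (t + 2 * T) - w (t + T))) / 2
      = - ((sin (\<delta> t) - sin (\<delta> (t + 2 * T))) / d)"
    by (simp add: w_def diff_divide_distrib)
  finally show "(a has_real_derivative - (2 / d * (cos (B t) * sin (b t)))) (at t)"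
    unfolding sin_sums by (simp add: mult_ac)
  have "(b has_real_derivative (w (t + T) - w t - (w (t + 2 * T) - w (t + T))) / 2) (at t)"
    unfolding b using DERIV_cdivide[OF DERIV_diff[OF \<delta>_sum_deriv[of t] S1]] by simp
  also have "(w (t + T) - w t - (w (t + 2 * T) - w (t + T))) / 2 = (w (t + T) - w (t + 3 * T)) / 2"
    using w_balance[of t] by (simp add: algebra_simps)
  also have "\<dots> = (sin (\<delta> (t + T)) - sin (\<delta> (t + 3 * T))) / d"
    by (simp add: w_def diff_divide_distrib)
  finally show "(b has_real_derivative 2 / d * (cos (A t) * sin (a t))) (at t)"
    unfolding sin_sums by (simp add: mult_ac)
qed

definition z :: "real \<Rightarrow> complex" where "z t = Complex (a t) (b t)"

text \<open>A shift by \<open>T\<close> permutes the four angles cyclically, since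
  \<open>\<delta> (t + 4 * T) = \<delta> t\<close>.\<close>

lemma z_shift: "z (t + T) = \<i> * z t"
proof -
  have "b (t + T) = a t" "a (t + T) = - b t"
    unfolding a_def b_def shift_sums four_shifts by (simp_all add: diff_divide_distrib)
  then show ?thesis by (simp add: z_def complex_eq_iff)
qed

lemma z_deriv:
  "(z has_vector_derivative 2 / d * Complex (- (cos (B t) * sin (b t))) (cos (A t) * sin (a t))) (at t)"
proof -
  have "((\<lambda>t. of_real (a t) + of_real (b t) * \<i>) has_vector_derivative
     of_real (- (2 / d * (cos (B t) * sin (b t)))) + of_real (2 / d * (cos (A t) * sin (a t))) * \<i>) (at t)"
    using ab_deriv[of t]
    by (intro has_vector_derivative_add has_vector_derivative_mult_left has_vector_derivative_of_real)
       (auto simp: has_real_derivative_iff_has_vector_derivative)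
  moreover have "(\<lambda>t. of_real (a t) + of_real (b t) * \<i>) = z"
    by (auto simp: fun_eq_iff z_def complex_eq_iff)
  ultimately show ?thesis by (auto simp: complex_eq_iff elim!: has_vector_derivative_eq_rhs)
qed

text \<open>Average the antiderivatives of \<open>w\<close> over the four shifts by multiples of
  \<open>T\<close>. In the sum of the increments each of the four angles occurs twice, which gives
  \<open>2 * (4 * \<sigma> * pi) / 4\<close>.\<close>

lemma q_antiderivative:
  "\<exists>F. (\<forall>s\<in>{t..t+T}. (F has_real_derivative 2 * q s / d) (at s)) \<and> F (t + T) - F t = 2 * \<sigma> * pi"
proof -
  have "\<exists>F. (\<forall>s\<in>{t..t+T}. (F has_real_derivative w (s + c)) (at s)) \<and>
      F (t + T) - F t = \<delta> (t + c) + \<delta> (t + c + T)" for c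
  proof -
    obtain F where F: "\<forall>s\<in>{t+c..t+c+T}. (F has_real_derivative w s) (at s)"
      "F (t + c + T) - F (t + c) = \<delta> (t + c) + \<delta> (t + c + T)" using w_antiderivative[of "t + c"] by blast
    show ?thesis
    proof (intro exI[of _ "\<lambda>s. F (s + c)"] conjI ballI)
      fix s assume "s \<in> {t..t+T}"
      then have "(F has_real_derivative w (s + c)) (at (s + c))" using F(1) by auto
      then show "((\<lambda>s. F (s + c)) has_real_derivative w (s + c)) (at s)" by (simp add: DERIV_shift)
    next
      show "F (t + T + c) - F (t + c) = \<delta> (t + c) + \<delta> (t + c + T)" using F(2) by (simp add: algebra_simps)
    qed
  qed
  then obtain F where F: "\<And>c s. s \<in> {t..t+T} \<Longrightarrow> (F c has_real_derivative w (s + c)) (at s)"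
    and \<Delta>: "\<And>c. F c (t + T) - F c t = \<delta> (t + c) + \<delta> (t + c + T)" by metis
  let ?F = "\<lambda>s. (F 0 s + F T s + F (2 * T) s + F (3 * T) s) / 4"
  have "(?F has_real_derivative 2 * q s / d) (at s)" if "s \<in> {t..t+T}" for s
  proof -
    have "(?F has_real_derivative (w s + w (s + T) + w (s + 2 * T) + w (s + 3 * T)) / 4) (at s)"
      using F[OF that, of 0] F[OF that, of T] F[OF that, of "2 * T"] F[OF that, of "3 * T"]
      by (auto intro!: derivative_eq_intros)
    then show ?thesis unfolding w_sum by simp
  qed
  moreover have "?F (t + T) - ?F t = 2 * \<sigma> * pi"
    using \<Delta>[of 0] \<Delta>[of T] \<Delta>[of "2 * T"] \<Delta>[of "3 * T"] \<delta>_sum[of t]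
    unfolding shift_sums four_shifts add_0_right mult.assoc add_divide_distrib by linarith
  ultimately show ?thesis by blast
qed

lemma q_pos: "0 < q t"
proof -
  have "0 < 8 * q t / d"
    using w_pos[of t] w_pos[of "t + T"] w_pos[of "t + 2 * T"] w_pos[of "t + 3 * T"] w_sum[of t] by simp
  then show ?thesis using d_pos by (simp add: zero_less_divide_iff)
qed

lemma ab_bounds: "\<bar>a t\<bar> < A t" "\<bar>b t\<bar> < B t" "\<bar>a t\<bar> < pi / 2 - A t" "\<bar>b t\<bar> < pi / 2 - B t"
proof -
  have abs_half: "\<bar>x - y\<bar> / 2 < (x + y) / 2" "\<bar>x - y\<bar> / 2 < pi / 2 - (x + y) / 2"
    if "0 < x" "0 < y" "x < pi / 2" "y < pi / 2" for x y :: real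
    using that by (auto simp: abs_if add_divide_distrib diff_divide_distrib)
  show "\<bar>a t\<bar> < A t" "\<bar>b t\<bar> < B t" "\<bar>a t\<bar> < pi / 2 - A t" "\<bar>b t\<bar> < pi / 2 - B t"
    unfolding a_def b_def A_def B_def abs_divide abs_numeral
    by (rule abs_half \<delta>_bounds)+
qed

lemma phase_mult:
  assumes "(f has_vector_derivative \<i> * of_real x * f t) (at t)"
    and "(h has_vector_derivative \<i> * of_real y * h t) (at t)"
  shows "((\<lambda>t. f t * h t) has_vector_derivative \<i> * of_real (x + y) * (f t * h t)) (at t)"
  using has_vector_derivative_mult[OF assms] by (simp add: algebra_simps)

text \<open>The product \<open>E\<close> of four consecutive chord directions turns four times as fast as the mean
  direction of the chords, which gains \<open>\<pi> / 4\<close> during a time \<open>T\<close> when \<open>\<sigma> = 1 / 8\<close>; passing to the frame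
  \<open>E\<close> makes the motion of \<open>z\<close> slow. For \<open>\<sigma> = 3 / 8\<close> it is slow already.\<close>

lemma z_zero: "z t = 0"
proof (cases "\<sigma> = 1 / 8")
  case True
  then have s1: "4 * \<sigma> * pi = pi / 2" by simp
  define E where "E t = e t * e (t + T) * e (t + 2 * T) * e (t + 3 * T)" for t
  define z' where "z' t = 2 / d * Complex (- (cos (B t) * sin (b t))) (cos (A t) * sin (a t))" for t
  have Ed: "(E has_vector_derivative \<i> * of_real (8 * q t / d) * E t) (at t)" for t
    unfolding E_def[abs_def] w_sum[symmetric]
    by (intro phase_mult has_vector_derivative_shift e_deriv)
  have En: "norm (E t) = 1" for t using e_unit by (simp add: E_def norm_mult)
  \<comment> \<open>The shift replaces the factor \<open>e t\<close> by
    \<open>e (t + 4 * T) = - e t\<close>.\<close>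
  have E_shift: "E (t + T) = - E t" for t by (simp add: E_def shift_sums four_shifts)
  define u where "u t = z t * cnj (E t)" for t
  have "u t = 0"
  \<comment> \<open>\<open>\<epsilon>\<close> comes from \<open>trig_eighth\<close>,
    \<open>\<Delta>\<close> is \<open>2 * \<sigma> * pi\<close>, and \<open>k\<close> combines the
    factor \<open>\<i>\<close> of \<open>z_shift\<close> with the sign of \<open>E_shift\<close>.
    The margin is small: the product is about 1.374, against \<open>sqrt 2\<close>.\<close>
  proof (rule quasi_periodic_zero[where T = T and u = u and \<omega> = "\<lambda>t. 2 * q t / d" and \<epsilon> = "7 / 4"
        and \<Delta> = "pi / 4" and k = "- \<i>" and u' = "\<lambda>t. z t * cnj (\<i> * of_real (8 * q t / d) * E t) + z' t * cnj (E t)"])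
    show "0 < T" by (rule T_bounds)
    show "(u has_vector_derivative z t * cnj (\<i> * of_real (8 * q t / d) * E t) + z' t * cnj (E t)) (at t)" for t
      unfolding u_def[abs_def] z'_def
      by (intro has_vector_derivative_mult z_deriv Ed
          bounded_linear.has_vector_derivative[OF bounded_linear_cnj])
    show "norm (z t * cnj (\<i> * of_real (8 * q t / d) * E t) + z' t * cnj (E t)) \<le> 7 / 4 * (2 * q t / d) * norm (u t)" for t
    proof -
      \<comment> \<open>The rotation of the frame subtracts exactly the linear terms
        \<open>4 * q t * b t\<close> and \<open>4 * q t * a t\<close>.\<close>
      have eq: "z t * cnj (\<i> * of_real (8 * q t / d) * E t) + z' t * cnj (E t)
        = of_real (2 / d) * Complex (- (cos (B t) * sin (b t) - 4 * q t * b t)) (cos (A t) * sin (a t) - 4 * q t * a t)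
           * cnj (E t)"
        using d_pos by (simp add: z'_def z_def complex_eq_iff field_simps)
      have "norm (z t * cnj (\<i> * of_real (8 * q t / d) * E t) + z' t * cnj (E t))
        = 2 / d * norm (Complex (- (cos (B t) * sin (b t) - 4 * q t * b t)) (cos (A t) * sin (a t) - 4 * q t * a t))"
        unfolding eq using d_pos by (simp only: norm_mult complex_mod_cnj En norm_of_real) simp
      also have "\<dots> \<le> 2 / d * (7 / 4 * q t * norm (Complex (b t) (a t)))"
      proof (rule mult_left_mono, rule norm_sum_sq_bound)
        have AB: "A t + B t = pi / 4" using AB_sum[of t] s1 by linarith
        show "\<bar>cos (A t) * sin (a t) - 4 * q t * a t\<bar> \<le> 7 / 4 * q t * \<bar>a t\<bar>"
          by (rule trig_eighth[OF AB ab_bounds(1,2) q_def q_eq])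
        show "\<bar>- (cos (B t) * sin (b t) - 4 * q t * b t)\<bar> \<le> 7 / 4 * q t * \<bar>b t\<bar>"
          unfolding abs_minus_cancel
          by (rule trig_eighth[OF _ ab_bounds(2,1) q_eq q_def]) (simp only: AB add.commute[of "B t"])
      qed (use q_pos[of t] d_pos in auto)
      also have "norm (Complex (b t) (a t)) = norm (u t)"
        by (simp add: u_def norm_mult En z_def complex_norm add.commute)
      finally show ?thesis by (simp add: algebra_simps)
    qed
    show "\<exists>F. (\<forall>s\<in>{t..t + T}. (F has_real_derivative 2 * q s / d) (at s)) \<and> F (t + T) - F t = pi / 4" for t
    proof -
      have "2 * \<sigma> * pi = pi / 4" using True by simp
      then show ?thesis using q_antiderivative[of t] by (simp only:)
    qed
    show "u (t + T) = - \<i> * u t" for t by (simp add: u_def z_shift E_shift)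
    have "norm (- \<i> - 1) = sqrt 2" by (simp add: cmod_def)
    moreover have "7 / 4 * (pi / 4) < sqrt 2"
    proof -
      have "7 / 4 * (pi / 4) < 7 / 5" using pi_approx by simp
      also have "7 / 5 < sqrt 2" by (rule real_less_rsqrt) (simp add: power2_eq_square)
      finally show ?thesis .
    qed
    ultimately show "7 / 4 * (pi / 4) < norm (- \<i> - 1)" by simp
  qed (use q_pos d_pos in \<open>auto intro: less_imp_le\<close>)
  then show ?thesis using En[of t] by (auto simp: u_def)
next
  case False
  then have \<sigma>3: "\<sigma> = 3 / 8" using \<sigma>_cases by auto
  then have s3: "4 * \<sigma> * pi = 3 * pi / 2" by simp
  have s2: "0 < 2 - sqrt 2" using real_sqrt_less_mono[of 2 4] by simp
  show ?thesis
  proof (rule quasi_periodic_zero[where T = T and u = z and \<omega> = "\<lambda>t. 2 * q t / d" and \<epsilon> = "2 - sqrt 2"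
        and \<Delta> = "3 * pi / 4" and k = "\<i>"])
    show "0 < T" by (rule T_bounds)
    show "(z has_vector_derivative 2 / d * Complex (- (cos (B t) * sin (b t))) (cos (A t) * sin (a t))) (at t)" for t
      by (rule z_deriv)
    show "norm (2 / d * Complex (- (cos (B t) * sin (b t))) (cos (A t) * sin (a t)))
        \<le> (2 - sqrt 2) * (2 * q t / d) * norm (z t)" for t
    proof -
      have "norm (2 / d * Complex (- (cos (B t) * sin (b t))) (cos (A t) * sin (a t)))
        = 2 / d * norm (Complex (- (cos (B t) * sin (b t))) (cos (A t) * sin (a t)))"
        using d_pos by (simp add: norm_mult norm_divide)
      also have "\<dots> \<le> 2 / d * ((2 - sqrt 2) * q t * norm (Complex (b t) (a t)))"
      proof (rule mult_left_mono, rule norm_sum_sq_bound)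
        have AB: "A t + B t = 3 * pi / 4" using AB_sum[of t] s3 by linarith
        show "\<bar>cos (A t) * sin (a t)\<bar> \<le> (2 - sqrt 2) * q t * \<bar>a t\<bar>"
          by (rule trig_three_eighths[OF AB ab_bounds(3,4) q_def q_eq])
        show "\<bar>- (cos (B t) * sin (b t))\<bar> \<le> (2 - sqrt 2) * q t * \<bar>b t\<bar>"
          unfolding abs_minus_cancel
          by (rule trig_three_eighths[OF _ ab_bounds(4,3) q_eq q_def]) (simp only: AB add.commute[of "B t"])
      qed (use q_pos[of t] d_pos s2 in auto)
      also have "norm (Complex (b t) (a t)) = norm (z t)"
        by (simp add: z_def complex_norm add.commute)
      finally show ?thesis by (simp only: times_divide_eq_left times_divide_eq_right mult_ac)
    qed
    show "\<exists>F. (\<forall>s\<in>{t..t + T}. (F has_real_derivative 2 * q s / d) (at s)) \<and> F (t + T) - F t = 3 * pi / 4" for t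
    proof -
      have "2 * \<sigma> * pi = 3 * pi / 4" using \<sigma>3 by simp
      then show ?thesis using q_antiderivative[of t] by (simp only:)
    qed
    show "z (t + T) = \<i> * z t" for t by (rule z_shift)
    have "norm (\<i> - 1) = sqrt 2" by (simp add: cmod_def)
    moreover have "(2 - sqrt 2) * (3 * pi / 4) < sqrt 2"
    proof -
      have s141: "141 / 100 < sqrt 2" by (rule real_less_rsqrt) (simp add: power2_eq_square)
      \<comment> \<open>\<open>59 / 25 = 2.36\<close> lies just above
        \<open>3 * pi / 4\<close>.\<close>
      then have "(2 - sqrt 2) * (3 * pi / 4) < (59 / 100) * (59 / 25)"
        using pi_approx s2 by (intro mult_strict_mono) auto
      also have "\<dots> < 141 / 100" by simp
      finally show ?thesis using s141 by (rule less_trans)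
    qed
    ultimately show "(2 - sqrt 2) * (3 * pi / 4) < norm (\<i> - 1)" by simp
  qed (use q_pos d_pos s2 in \<open>auto intro: less_imp_le\<close>)
qed

text \<open>With \<open>z t = 0\<close> opposite angles agree, and \<open>q_eq\<close> reduces to
  \<open>sin (A t) = sin (B t)\<close> for acute angles; so all four angles are equal to a quarter
  of their sum.\<close>

lemma \<delta>_const: "\<delta> t = \<sigma> * pi"
proof -
  have ab: "a t = 0" "b t = 0" using z_zero[of t] by (auto simp: z_def complex_eq_iff)
  have "sin (A t) = sin (B t)" using q_eq[of t] ab by (simp add: q_def)
  then have "A t = B t"
    by (rule sin_inj_pi[rotated 4]) (use ab_bounds[of t] pi_gt_zero in linarith)+
  then show ?thesis using AB_sum[of t] ab by (simp add: A_def B_def a_def b_def)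
qed

text \<open>Successive chord directions now differ by the fixed rotation
  \<open>cis (2 * (\<sigma> * pi))\<close>, so \<open>- 2 * g t\<close> is \<open>d * e t\<close>
  times a number independent of \<open>t\<close>.\<close>

lemma norm_const: "norm (g t) = norm (g 0)"
proof -
  have "norm (g t) = d / 2 * norm (\<Sum>k<4. cis (2 * of_nat k * (\<sigma> * pi)))" for t
  proof -
    have e2: "e (t + T) = e t * cis (2 * (\<sigma> * pi))" for t
      by (simp only: e_shift \<delta>_const mult_2)
    have gd: "g (t + T) = g t + d * e t" for t using d_pos by (simp add: e_def)
    have "- 2 * g t = g (t + 4 * T) - g t" by (simp add: four_shifts)
    also have "\<dots> = d * (e t + e (t + T) + e (t + 2 * T) + e (t + 3 * T))"
      using gd[of t] gd[of "t + T"] gd[of "t + 2 * T"] gd[of "t + 3 * T"]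
      by (simp add: shift_sums algebra_simps)
    also have "\<dots> = d * e t * (\<Sum>k<4. cis (2 * of_nat k * (\<sigma> * pi)))"
      using e2[of t] e2[of "t + T"] e2[of "t + 2 * T"]
      by (simp add: shift_sums eval_nat_numeral algebra_simps cis_mult)
    finally have "norm (- 2 * g t) = norm (d * e t * (\<Sum>k<4. cis (2 * of_nat k * (\<sigma> * pi))))" by simp
    then show ?thesis using d_pos e_unit[of t] by (simp add: norm_mult)
  qed
  then show ?thesis by metis
qed

end

subsection \<open>Bodies bounded by a sphere\<close>

text \<open>A connected set missing \<open>frontier K\<close> lies inside or outside
  \<open>K\<close>. The open ball contains \<open>c\<close> and is inside; the complement of the
  closed ball, connected in dimension at least 2, is unbounded and hence outside.\<close>

lemma eq_cball_of_frontier_subset_sphere: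
  fixes K :: "'a::euclidean_space set"
  assumes "compact K" "convex K" "c \<in> interior K" "frontier K \<subseteq> sphere c r" "2 \<le> DIM('a)"
  shows "0 < r" "K = cball c r"
proof -
  have K: "closed K" "bounded K" using assms(1) by (auto simp: compact_imp_closed compact_imp_bounded)
  have cK: "c \<in> K" using assms(3) interior_subset by auto
  have "K \<noteq> UNIV" using K(2) not_bounded_UNIV by auto
  then obtain x where x: "x \<in> frontier K" using cK frontier_eq_empty[of K] by auto
  then have "x \<noteq> c" using assms(3) by (auto simp: frontier_def)
  then show r: "0 < r" using x assms(4) by (auto simp: subset_iff)
  have "ball c r \<inter> frontier K = {}" using assms(4) by (auto simp: subset_iff)
  then have "ball c r - K = {}"
    using connected_Int_frontier[OF connected_ball, of c r K] r cK centre_in_ball[of c r] by blast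
  then have "closure (ball c r) \<subseteq> K" using K(1) by (intro closure_minimal) auto
  then have 1: "cball c r \<subseteq> K" using r by simp
  have con: "connected (- cball c r)"
    using assms(5) by (intro connected_complement_bounded_convex) auto
  have "- cball c r \<inter> frontier K = {}" using assms(4) by (auto simp: subset_iff)
  moreover have "- cball c r - K \<noteq> {}"
  proof
    assume "- cball c r - K = {}"
    then have "UNIV = cball c r \<union> K" by auto
    then have "bounded (UNIV :: 'a set)" using K(2) by (metis bounded_Un bounded_cball)
    then show False by simp
  qed
  ultimately have "- cball c r \<inter> K = {}" using connected_Int_frontier[OF con, of K] by blast
  then show "K = cball c r" using 1 by auto
qed

subsection \<open>Arc length\<close>

lemma dist_le_arc_length:
  assumes "a \<le> b"
  shows "ereal (dist (\<gamma> a) (\<gamma> b)) \<le> arc_length \<gamma> a b"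
  unfolding arc_length_def
proof (rule Sup_upper, rule CollectI, intro exI conjI)
  let ?u = "\<lambda>i::nat. if i = 0 then a else b"
  show "ereal (dist (\<gamma> a) (\<gamma> b)) = ereal (\<Sum>i<1. dist (\<gamma> (?u i)) (\<gamma> (?u (Suc i))))" by simp
  show "mono ?u" using assms by (auto simp: mono_def)
qed auto

text \<open>The bounds on the segments of an inscribed polygon telescope. The function
  \<open>h\<close> allows lengths to be estimated through a change of parameter.\<close>

lemma arc_length_le:
  assumes "\<And>x y. a \<le> x \<Longrightarrow> x \<le> y \<Longrightarrow> y \<le> b \<Longrightarrow> dist (\<gamma> x) (\<gamma> y) \<le> M * (h y - h x)"
  shows "arc_length \<gamma> a b \<le> ereal (M * (h b - h a))"
  unfolding arc_length_def
proof (rule Sup_least, clarify)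
  fix n and u :: "nat \<Rightarrow> real"
  assume u: "mono u" "a = u 0" "b = u n"
  have "(\<Sum>i<n. dist (\<gamma> (u i)) (\<gamma> (u (Suc i)))) \<le> (\<Sum>i<n. M * (h (u (Suc i)) - h (u i)))"
    using u by (intro sum_mono assms) (auto intro!: monoD[OF u(1)])
  also have "\<dots> = M * (h (u n) - h (u 0))"
    using sum_lessThan_telescope[of "\<lambda>i. h (u i)" n] by (simp flip: sum_distrib_left)
  finally show "ereal (\<Sum>i<n. dist (\<gamma> (u i)) (\<gamma> (u (Suc i)))) \<le> ereal (M * (h (u n) - h (u 0)))" by simp
qed

lemma arc_length_parametrization_dist_le:
  assumes "arc_length_parametrization \<gamma> P K"
  shows "dist (\<gamma> s) (\<gamma> t) \<le> \<bar>t - s\<bar>"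
proof -
  have "dist (\<gamma> s) (\<gamma> t) \<le> t - s" if "s \<le> t" for s t
    using dist_le_arc_length[OF that, of \<gamma>] assms that by (simp add: arc_length_parametrization_def)
  from this[of s t] this[of t s] show ?thesis by (cases "s \<le> t") (auto simp: dist_commute)
qed

lemma arc_length_parametrization_continuous:
  assumes "arc_length_parametrization \<gamma> P K"
  shows "continuous_on S \<gamma>"
proof (rule continuous_on_subset)
  show "continuous_on UNIV \<gamma>"
    using arc_length_parametrization_dist_le[OF assms]
    by (intro lipschitz_on_continuous_on[of 1]) (auto simp: lipschitz_on_def dist_real_def abs_minus_commute)
qed simp

lemma arc_length_parametrization_le:
  assumes "arc_length_parametrization \<gamma> P K" "s \<le> t"
    and "\<And>x y. s \<le> x \<Longrightarrow> x \<le> y \<Longrightarrow> y \<le> t \<Longrightarrow> dist (\<gamma> x) (\<gamma> y) \<le> M * (h y - h x)"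
  shows "t - s \<le> M * (h t - h s)"
  using arc_length_le[of s t \<gamma> M h] assms by (auto simp: arc_length_parametrization_def)

subsection \<open>Comparing two parametrizations of the same boundary\<close>

lemma parametrizes_boundary_shift_int:
  assumes "parametrizes_boundary \<phi> L K"
  shows "\<phi> (s + of_int k * L) = \<phi> s"
proof (induction k rule: int_induct[where k = 0])
  case (step1 i)
  then show ?case using assms by (auto simp: parametrizes_boundary_def algebra_simps dest: spec[of _ "s + of_int i * L"])
next
  case (step2 i)
  then show ?case using assms by (auto simp: parametrizes_boundary_def algebra_simps dest: spec[of _ "s + of_int (i - 1) * L"])
qed auto

lemma parametrizes_boundary_reduce:
  assumes "parametrizes_boundary \<phi> L K"
  obtains k :: int where "s + of_int k * L \<in> {0..<L}"
proof
  have L: "0 < L" using assms by (simp add: parametrizes_boundary_def)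
  have "of_int \<lfloor>s / L\<rfloor> \<le> s / L" "s / L < of_int \<lfloor>s / L\<rfloor> + 1" by linarith+
  then have "of_int \<lfloor>s / L\<rfloor> * L \<le> s" "s < (of_int \<lfloor>s / L\<rfloor> + 1) * L"
    using L by (simp_all only: pos_le_divide_eq pos_divide_less_eq)
  then show "s + of_int (- \<lfloor>s / L\<rfloor>) * L \<in> {0..<L}" by (simp add: algebra_simps)
qed

lemma parametrizes_boundary_eq_iff:
  assumes "parametrizes_boundary \<phi> L K"
  shows "\<phi> s = \<phi> t \<longleftrightarrow> (\<exists>k::int. t = s + of_int k * L)"
proof
  assume eq: "\<phi> s = \<phi> t"
  obtain k where k: "s + of_int k * L \<in> {0..<L}" using parametrizes_boundary_reduce[OF assms] .
  obtain l where l: "t + of_int l * L \<in> {0..<L}" using parametrizes_boundary_reduce[OF assms] .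
  have "\<phi> (s + of_int k * L) = \<phi> (t + of_int l * L)"
    using eq by (simp add: parametrizes_boundary_shift_int[OF assms])
  then have "s + of_int k * L = t + of_int l * L"
    using assms k l by (auto simp: parametrizes_boundary_def dest: inj_onD)
  then have "t = s + of_int (k - l) * L" by (simp add: algebra_simps)
  then show "\<exists>k::int. t = s + of_int k * L" by blast
qed (auto simp: parametrizes_boundary_shift_int[OF assms])

text \<open>The map \<open>E\<close> wraps the parameter line of \<open>\<phi>\<close> around the
  unit circle, and \<open>\<xi>\<close> identifies the boundary with that circle. A continuous
  logarithm of the nowhere vanishing \<open>\<xi> (\<gamma> t)\<close> yields the lift from its
  imaginary part.\<close>

lemma continuous_boundary_lift:
  fixes \<gamma> :: "real \<Rightarrow> real ^ 2"
  assumes \<phi>: "parametrizes_boundary \<phi> L K" "continuous_on UNIV \<phi>"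
    and \<gamma>: "continuous_on UNIV \<gamma>" "range \<gamma> \<subseteq> frontier K"
  obtains h where "continuous_on UNIV h" "\<And>t. \<gamma> t = \<phi> (h t)"
proof -
  have L: "0 < L" and rng: "range \<phi> = frontier K" using \<phi>(1) by (auto simp: parametrizes_boundary_def)
  define E :: "real \<Rightarrow> complex" where "E s = exp (of_real (2 * pi * s / L) * \<i>)" for s
  have E_eq: "E s = E t \<longleftrightarrow> \<phi> s = \<phi> t" for s t
  proof -
    have "E t = E s \<longleftrightarrow> (\<exists>k::int. t = s + of_int k * L)"
    proof -
      have "of_real (2 * pi * t / L) * \<i> = of_real (2 * pi * s / L) * \<i> + (of_int (2 * k) * pi) * \<i>
        \<longleftrightarrow> t = s + of_int k * L" for k :: int
      proof -
        have "of_real (2 * pi * t / L) * \<i> = of_real (2 * pi * s / L) * \<i> + (of_int (2 * k) * pi) * \<i>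
          \<longleftrightarrow> 2 * pi * t / L = 2 * pi * s / L + of_int (2 * k) * pi"
          by (simp add: complex_eq_iff)
        also have "2 * pi * s / L + of_int (2 * k) * pi = (2 * pi / L) * (s + of_int k * L)"
          using L by (simp add: field_simps)
        also have "2 * pi * t / L = (2 * pi / L) * t" by simp
        finally show ?thesis unfolding mult_cancel_left using L by simp
      qed
      then show ?thesis unfolding E_def exp_eq by auto
    qed
    then show ?thesis unfolding parametrizes_boundary_eq_iff[OF \<phi>(1)] by auto
  qed
  have E_cont: "continuous_on S E" for S
    unfolding E_def using L by (intro continuous_intros) auto
  define \<xi> where "\<xi> x = E (SOME s. \<phi> s = x)" for x
  have \<xi>: "\<xi> (\<phi> s) = E s" for s
    unfolding \<xi>_def E_eq by (rule someI) simp
  \<comment> \<open>Preimages of closed sets are closed: by periodicity they are images under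
    \<open>\<phi>\<close> of closed subsets of the compact interval \<open>{0..L}\<close>.\<close>
  have "continuous_on (range \<phi>) \<xi>"
    unfolding continuous_on_closed_invariant
  proof (intro allI impI)
    fix B :: "complex set" assume B: "closed B"
    let ?A = "\<phi> ` ({0..L} \<inter> E -` B)"
    have "closed ({0..L} \<inter> E -` B)"
      using E_cont B by (intro continuous_closed_preimage) auto
    then have "compact ({0..L} \<inter> E -` B)"
      by (simp add: compact_eq_bounded_closed bounded_Int)
    then have "closed ?A"
      using \<phi>(2) by (intro compact_imp_closed compact_continuous_image) (auto intro: continuous_on_subset)
    moreover have "?A \<inter> range \<phi> = \<xi> -` B \<inter> range \<phi>"
    proof (intro equalityI subsetI)
      fix x assume "x \<in> ?A \<inter> range \<phi>"
      then obtain s where "x = \<phi> s" "E s \<in> B" by blast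
      then show "x \<in> \<xi> -` B \<inter> range \<phi>" by (simp add: \<xi>)
    next
      fix x assume "x \<in> \<xi> -` B \<inter> range \<phi>"
      then obtain s where s: "x = \<phi> s" "E s \<in> B" using \<xi> by auto
      obtain k where k: "s + of_int k * L \<in> {0..<L}" using parametrizes_boundary_reduce[OF \<phi>(1)] .
      have p: "\<phi> (s + of_int k * L) = \<phi> s" by (rule parametrizes_boundary_shift_int[OF \<phi>(1)])
      then have "E (s + of_int k * L) \<in> B" using E_eq s by metis
      then show "x \<in> ?A \<inter> range \<phi>" using k p s by (auto intro!: image_eqI[of _ _ "s + of_int k * L"])
    qed
    ultimately show "\<exists>A. closed A \<and> A \<inter> range \<phi> = \<xi> -` B \<inter> range \<phi>" by blast
  qed
  then have c: "continuous_on UNIV (\<lambda>t. \<xi> (\<gamma> t))"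
    using \<gamma> rng by (intro continuous_on_compose2[of "range \<phi>" \<xi> UNIV \<gamma>]) auto
  have nz: "\<xi> (\<gamma> t) \<noteq> 0" for t
    using \<gamma>(2) rng \<xi> by (auto simp: \<xi>_def E_def)
  have ctr: "contractible (UNIV :: real set)" by (simp add: convex_imp_contractible)
  obtain g where g: "continuous_on UNIV g" "\<And>t. \<xi> (\<gamma> t) = exp (g t)"
    using continuous_logarithm_on_contractible[OF c ctr nz] by (metis UNIV_I)
  show ?thesis
  proof
    show "continuous_on UNIV (\<lambda>t. Im (g t) * L / (2 * pi))"
      using g(1) by (intro continuous_intros) auto
    show "\<gamma> t = \<phi> (Im (g t) * L / (2 * pi))" for t
    proof -
      obtain s where s: "\<gamma> t = \<phi> s" using \<gamma>(2) rng by (metis imageE range_subsetD)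
      then have e: "exp (g t) = E s" using g \<xi> by metis
      then have "norm (exp (g t)) = 1" by (simp add: E_def)
      then have "Re (g t) = 0" by simp
      moreover have "2 * pi * (Im (g t) * L / (2 * pi)) / L = Im (g t)" using L by simp
      ultimately have "of_real (2 * pi * (Im (g t) * L / (2 * pi)) / L) * \<i> = g t"
        by (simp only: complex_eq_iff) simp
      then have "E (Im (g t) * L / (2 * pi)) = E s" unfolding e[symmetric] by (simp only: E_def)
      then show ?thesis unfolding E_eq s by simp
    qed
  qed
qed

text \<open>A continuous injective function is monotone; the positive increment \<open>Q\<close> per
  period excludes a decreasing one and makes the range unbounded in both directions.\<close>

lemma continuous_inj_quasi_periodic:
  fixes h :: "real \<Rightarrow> real"
  assumes h: "continuous_on UNIV h" "inj h" and P: "0 < P" "0 < Q" and per: "\<And>t. h (t + P) = h t + Q"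
  shows "strict_mono h" "surj h"
proof -
  have n: "h (t + real n * P) = h t + real n * Q" for t n
    by (induction n) (use per in \<open>auto simp: algebra_simps\<close>, metis add.assoc add.commute)
  show "strict_mono h"
  proof (rule strict_monoI)
    fix s t :: real assume st: "s < t"
    obtain n :: nat where "(t - s) / P < n" using reals_Archimedean2 by blast
    then have "t < s + real n * P" using P by (simp add: field_simps)
    then have "(h s < h t \<and> h t < h (s + real n * P)) \<or> (h (s + real n * P) < h t \<and> h t < h s)"
      using st h by (intro continuous_inj_imp_mono) (auto intro: continuous_on_subset inj_on_subset)
    moreover have "h s \<le> h (s + real n * P)" using n P by simp
    ultimately show "h s < h t" by linarith
  qed
  show "surj h"
  proof (rule surjI[of h "\<lambda>y. SOME x. h x = y"], rule someI_ex)
    fix y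
    obtain m :: nat where m: "\<bar>y - h 0\<bar> / Q < m" using reals_Archimedean2 by blast
    then have m': "\<bar>y - h 0\<bar> < m * Q" using P by (simp add: field_simps)
    have 1: "h (real m * P) = h 0 + m * Q" using n[of 0 m] by simp
    have 2: "h (- real m * P) = h 0 - m * Q" using n[of "- real m * P" m] by simp
    have "\<exists>x. - real m * P \<le> x \<and> x \<le> real m * P \<and> h x = y"
      using m' 1 2 P h(1) by (intro IVT') (auto intro: continuous_on_subset)
    then show "\<exists>x. h x = y" by blast
  qed
qed

text \<open>The sign covers the two possible orientations.\<close>

lemma boundary_reparametrization:
  assumes \<phi>: "parametrizes_boundary \<phi> L K" "continuous_on UNIV \<phi>"
    and \<gamma>: "parametrizes_boundary \<gamma> P K" "continuous_on UNIV \<gamma>"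
  obtains h where "continuous_on UNIV h" "strict_mono h" "surj h"
    "(\<forall>t. \<gamma> t = \<phi> (h t)) \<or> (\<forall>t. \<gamma> t = \<phi> (- h t))"
proof -
  have L: "0 < L" and P: "0 < P" and rng: "range \<gamma> = frontier K"
    using \<phi>(1) \<gamma>(1) by (auto simp: parametrizes_boundary_def)
  obtain h where h: "continuous_on UNIV h" "\<And>t. \<gamma> t = \<phi> (h t)"
    using continuous_boundary_lift[OF \<phi> \<gamma>(2)] rng by auto
  have "\<exists>k::int. h (t + P) = h t + of_int k * L" for t
  proof -
    have "\<phi> (h t) = \<phi> (h (t + P))" using h(2) \<gamma>(1) by (metis parametrizes_boundary_def)
    then show ?thesis using parametrizes_boundary_eq_iff[OF \<phi>(1)] by auto
  qed
  then obtain k where k: "\<And>t. h (t + P) = h t + of_int (k t) * L" by metis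
  have kc: "continuous_on UNIV (\<lambda>t. of_int (k t) :: real)"
  proof -
    have "continuous_on UNIV (\<lambda>t. h (t + P))"
      by (rule continuous_on_compose2[OF h(1)]) (auto intro!: continuous_intros)
    then have "continuous_on UNIV (\<lambda>t. (h (t + P) - h t) / L)"
      using h(1) L by (intro continuous_intros) auto
    moreover have "(h (t + P) - h t) / L = of_int (k t)" for t using k[of t] L by simp
    ultimately show ?thesis by simp
  qed
  \<comment> \<open>The number of turns of the lift over one period is continuous and integer
    valued, hence a constant \<open>m\<close>.\<close>
  have "(\<lambda>t. of_int (k t) :: real) constant_on UNIV"
  proof (rule continuous_discrete_range_constant[OF connected_UNIV kc])
    fix x
    show "\<exists>e>0. \<forall>y. y \<in> UNIV \<and> real_of_int (k y) \<noteq> real_of_int (k x) \<longrightarrow> e \<le> norm (real_of_int (k y) - real_of_int (k x))"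
      by (intro exI[of _ 1]) (auto simp flip: of_int_diff of_int_abs)
  qed
  then obtain m :: int where m: "\<And>t. h (t + P) = h t + of_int m * L"
    using k unfolding constant_on_def by (metis UNIV_I of_int_eq_iff)
  have m': "h (t + of_int j * P) = h t + of_int j * (of_int m * L)" for t and j :: int
  proof (induction j rule: int_induct[where k = 0])
    case (step1 i)
    then show ?case using m[of "t + of_int i * P"] by (simp add: algebra_simps)
  next
    case (step2 i)
    then show ?case using m[of "t + of_int (i - 1) * P"] by (simp add: algebra_simps)
  qed auto
  have heq: "\<exists>j::int. t = s + of_int j * P" if "h s = h t" for s t
    using h(2) that parametrizes_boundary_eq_iff[OF \<gamma>(1), of s t] by metis
  have "m \<noteq> 0"
  proof
    assume "m = 0"
    then have 0: "h P = h 0" using m[of 0] by simp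
    have inj: "inj_on h {a..b}" if "b - a < P" for a b
    proof (rule inj_onI)
      fix x y assume xy: "x \<in> {a..b}" "y \<in> {a..b}" "h x = h y"
      obtain j :: int where j: "y = x + of_int j * P" using heq[OF xy(3)] by blast
      have "of_int j * P < 1 * P" "(- 1) * P < of_int j * P" 
        using xy(1,2) j that unfolding atLeastAtMost_iff by linarith+
      then have "real_of_int j < 1" "- 1 < real_of_int j" using P by (simp_all only: mult_less_cancel_right_pos)
      then have "j = 0" by linarith
      then show "x = y" using j by simp
    qed
    \<comment> \<open>On intervals shorter than \<open>P\<close> the lift is injective, so monotone.
      The two intervals used here overlap between \<open>P/3\<close> and \<open>2*P/3\<close>, so
      the directions agree, against \<open>h P = h 0\<close>.\<close>
    have "(h 0 < h (P/3) \<and> h (P/3) < h (2*P/3)) \<or> (h (2*P/3) < h (P/3) \<and> h (P/3) < h 0)"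
      using P h(1) inj[of "2*P/3" 0] by (intro continuous_inj_imp_mono) (auto intro: continuous_on_subset)
    moreover have "(h (P/3) < h (2*P/3) \<and> h (2*P/3) < h P) \<or> (h P < h (2*P/3) \<and> h (2*P/3) < h (P/3))"
      using P h(1) inj[of P "P/3"] by (intro continuous_inj_imp_mono) (auto intro: continuous_on_subset)
    ultimately show False using 0 by linarith
  qed
  have inj: "inj h"
  proof (rule injI)
    fix x y assume xy: "h x = h y"
    obtain j :: int where j: "y = x + of_int j * P" using heq[OF xy] by blast
    then have "real_of_int j * (of_int m * L) = 0" using m'[of x j] xy by simp
    then show "x = y" using j \<open>m \<noteq> 0\<close> L by simp
  qed
  show ?thesis
  proof (cases "0 < m")
    case True
    then have "0 < of_int m * L" using L by simp
    note sm = continuous_inj_quasi_periodic[OF h(1) inj P this m]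
    show ?thesis using that[OF h(1) sm] h(2) by blast
  next
    case False
    then have Q: "0 < - (of_int m * L)" using L \<open>m \<noteq> 0\<close> by (simp add: mult_less_0_iff)
    have c: "continuous_on UNIV (\<lambda>t. - h t)" using h(1) by (intro continuous_intros)
    have i: "inj (\<lambda>t. - h t)" using inj by (auto simp: inj_def)
    note sm = continuous_inj_quasi_periodic[OF c i P Q]
    show ?thesis using that[OF c sm] h(2) m by auto
  qed
qed

subsection \<open>Smoothness of the arc length parametrization\<close>

lemma strict_mono_surj_inverse:
  fixes h :: "real \<Rightarrow> real"
  assumes "strict_mono h" "surj h"
  shows "h (inv h y) = y" "inv h (h x) = x" "strict_mono (inv h)"
proof -
  have i: "inj h" using assms(1) by (rule strict_mono_imp_inj_on)
  show 1: "h (inv h y) = y" for y using assms(2) by (rule surj_f_inv_f)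
  show "inv h (h x) = x" using i by simp
  show "strict_mono (inv h)"
    by (rule strict_monoI) (metis 1 assms(1) strict_mono_less)
qed

text \<open>The difference quotients of \<open>S\<close> are squeezed: from below by those of the
  chord length, which tend to \<open>norm (D a)\<close>, and from above by bounds on the speed near
  \<open>a\<close>, which continuity of \<open>D\<close> brings arbitrarily close to
  \<open>norm (D a)\<close>.\<close>

lemma has_real_derivative_of_arc_length:
  fixes \<phi> :: "real \<Rightarrow> 'a::real_normed_vector" and S :: "real \<Rightarrow> real"
  assumes \<phi>: "\<And>s. (\<phi> has_vector_derivative D s) (at s)" "continuous_on UNIV D"
    and lower: "\<And>x y. x \<le> y \<Longrightarrow> norm (\<phi> y - \<phi> x) \<le> S y - S x"
    and upper: "\<And>x y M. x \<le> y \<Longrightarrow> (\<And>s. x \<le> s \<Longrightarrow> s \<le> y \<Longrightarrow> norm (D s) \<le> M) \<Longrightarrow> S y - S x \<le> M * (y - x)"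
  shows "(S has_real_derivative norm (D a)) (at a)"
proof -
  have lower': "norm (\<phi> y - \<phi> a) / \<bar>y - a\<bar> \<le> (S y - S a) / (y - a)" if "y \<noteq> a" for y
  proof (cases "a < y")
    case True
    then show ?thesis using lower[of a y] by (simp add: divide_right_mono)
  next
    case False
    then have "y < a" using that by simp
    then have "norm (\<phi> y - \<phi> a) / \<bar>y - a\<bar> \<le> (S a - S y) / (a - y)"
      using lower[of y a] by (simp add: divide_right_mono norm_minus_commute)
    also have "\<dots> = (S y - S a) / (y - a)" by (metis minus_diff_eq minus_divide_divide)
    finally show ?thesis .
  qed
  have upper': "(S y - S a) / (y - a) \<le> M"
    if y: "y \<noteq> a" and M: "\<And>s. \<bar>s - a\<bar> \<le> \<bar>y - a\<bar> \<Longrightarrow> norm (D s) \<le> M" for y M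
  proof (cases "a < y")
    case True
    then have "S y - S a \<le> M * (y - a)" by (intro upper M) auto
    then show ?thesis using True by (simp add: pos_divide_le_eq)
  next
    case False
    then have ya: "y < a" using y by simp
    then have "S a - S y \<le> M * (a - y)" by (intro upper M) auto
    then have "(S a - S y) / (a - y) \<le> M" using ya by (simp add: pos_divide_le_eq)
    also have "(S a - S y) / (a - y) = (S y - S a) / (y - a)" by (metis minus_diff_eq minus_divide_divide)
    finally show ?thesis .
  qed
  have "((\<lambda>y. (S y - S a) / (y - a)) \<longlongrightarrow> norm (D a)) (at a)"
  proof (rule order_tendstoI)
    fix l assume "l < norm (D a)"
    then have e: "0 < (norm (D a) - l) / 2" by simp
    obtain \<delta> where \<delta>: "0 < \<delta>" "\<And>y. norm (y - a) < \<delta> \<Longrightarrow>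
        norm (\<phi> y - \<phi> a - (y - a) *\<^sub>R D a) \<le> (norm (D a) - l) / 2 * norm (y - a)"
      using \<phi>(1)[of a] e unfolding has_vector_derivative_def has_derivative_at_alt by meson
    show "\<forall>\<^sub>F y in at a. l < (S y - S a) / (y - a)"
      unfolding eventually_at
    proof (intro exI[of _ \<delta>] conjI ballI impI)
      fix y assume y: "y \<noteq> a \<and> dist y a < \<delta>"
      have "\<bar>y - a\<bar> * norm (D a) = norm ((y - a) *\<^sub>R D a)" by simp
      also have "\<dots> \<le> norm (\<phi> y - \<phi> a) + norm (\<phi> y - \<phi> a - (y - a) *\<^sub>R D a)"
        using norm_triangle_ineq4[of "\<phi> y - \<phi> a" "\<phi> y - \<phi> a - (y - a) *\<^sub>R D a"] by simp
      also have "\<dots> \<le> norm (\<phi> y - \<phi> a) + (norm (D a) - l) / 2 * \<bar>y - a\<bar>"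
        using \<delta>(2)[of y] y by (simp add: dist_norm)
      also have "\<dots> < norm (\<phi> y - \<phi> a) + (norm (D a) - l) * \<bar>y - a\<bar>"
        using e y by simp
      finally have "l * \<bar>y - a\<bar> < norm (\<phi> y - \<phi> a)" by (simp add: algebra_simps)
      then have "l < norm (\<phi> y - \<phi> a) / \<bar>y - a\<bar>" using y by (simp add: pos_less_divide_eq)
      also have "\<dots> \<le> (S y - S a) / (y - a)" using lower' y by blast
      finally show "l < (S y - S a) / (y - a)" .
    qed (rule \<delta>(1))
  next
    fix l assume "norm (D a) < l"
    then obtain M where M: "norm (D a) < M" "M < l" using dense by blast
    have "isCont (\<lambda>s. norm (D s)) a"
      using \<phi>(2) by (auto intro!: isCont_norm simp: continuous_on_eq_continuous_at)
    then have "((\<lambda>s. norm (D s)) \<longlongrightarrow> norm (D a)) (nhds a)"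
      unfolding isCont_def by (rule iffD1[OF tendsto_at_iff_tendsto_nhds])
    then have "\<forall>\<^sub>F s in nhds a. norm (D s) < M" using M(1) by (rule order_tendstoD(2))
    then obtain e where e: "0 < e" "\<And>s. dist s a < e \<Longrightarrow> norm (D s) < M"
      by (auto simp: eventually_nhds_metric)
    show "\<forall>\<^sub>F y in at a. (S y - S a) / (y - a) < l"
      unfolding eventually_at
    proof (intro exI[of _ e] conjI ballI impI)
      fix y assume y: "y \<noteq> a \<and> dist y a < e"
      then have "(S y - S a) / (y - a) \<le> M"
        using e(2) by (intro upper') (auto simp: dist_real_def intro!: less_imp_le)
      then show "(S y - S a) / (y - a) < l" using M(2) by simp
    qed (rule e(1))
  qed
  then show ?thesis by (simp add: has_field_derivative_iff)
qed

text \<open>Write \<open>\<gamma>\<close> as a regular parametrization \<open>\<phi>\<close>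
  composed with \<open>h\<close>. The inverse of \<open>h\<close> is an arc length function of
  \<open>\<phi>\<close>, so its derivative is the nonzero speed; inverting it and applying the chain
  rule gives the unit tangent.\<close>

lemma arc_length_parametrization_C1:
  assumes K: "C1_boundary K" and \<gamma>: "arc_length_parametrization \<gamma> P K"
  obtains v where "\<And>t. (\<gamma> has_vector_derivative v t) (at t)" "continuous_on UNIV v" "\<And>t. norm (v t) = 1"
proof -
  obtain \<phi>0 L where \<phi>0: "parametrizes_boundary \<phi>0 L K" "\<phi>0 C1_differentiable_on UNIV"
    "\<And>t. vector_derivative \<phi>0 (at t) \<noteq> 0"
    using K unfolding C1_boundary_def by blast
  obtain D0 where D0: "\<And>t. (\<phi>0 has_vector_derivative D0 t) (at t)" "continuous_on UNIV D0"
    using \<phi>0(2) unfolding C1_differentiable_on_def by auto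
  have D0nz: "D0 t \<noteq> 0" for t using \<phi>0(3)[of t] vector_derivative_at[OF D0(1)] by simp
  have \<phi>0c: "continuous_on UNIV \<phi>0"
    using D0(1) by (intro continuous_at_imp_continuous_on) (auto intro: has_vector_derivative_continuous)
  have \<gamma>b: "parametrizes_boundary \<gamma> P K" using \<gamma> by (simp add: arc_length_parametrization_def)
  obtain h where h: "continuous_on UNIV h" "strict_mono h" "surj h"
    "(\<forall>t. \<gamma> t = \<phi>0 (h t)) \<or> (\<forall>t. \<gamma> t = \<phi>0 (- h t))"
    using boundary_reparametrization[OF \<phi>0(1) \<phi>0c \<gamma>b arc_length_parametrization_continuous[OF \<gamma>]] .
  \<comment> \<open>If the orientations disagree, \<open>\<phi>0\<close> is traversed
    backwards.\<close>
  obtain \<phi> D where \<phi>: "\<And>t. (\<phi> has_vector_derivative D t) (at t)" "continuous_on UNIV D"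
    "\<And>t. D t \<noteq> 0" "\<And>t. \<gamma> t = \<phi> (h t)"
  proof (cases "\<forall>t. \<gamma> t = \<phi>0 (h t)")
    case True
    then show ?thesis using that[OF D0 D0nz] by blast
  next
    case False
    have "((\<lambda>t. \<phi>0 (- t)) has_vector_derivative - D0 (- t)) (at t)" for t
    proof -
      have "(uminus has_vector_derivative -1) (at t)"
        unfolding has_real_derivative_iff_has_vector_derivative[symmetric]
        by (auto intro!: derivative_eq_intros)
      from vector_diff_chain_at[OF this D0(1)] show ?thesis by (simp add: o_def)
    qed
    moreover have "continuous_on UNIV (\<lambda>t. - D0 (- t))"
      by (intro continuous_on_minus continuous_on_compose2[OF D0(2)]) (auto intro!: continuous_intros)
    ultimately show ?thesis using that[of "\<lambda>t. \<phi>0 (- t)" "\<lambda>t. - D0 (- t)"] D0nz False h(4) by auto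
  qed
  define S where "S = inv h"
  have S: "h (S y) = y" "S (h x) = x" "strict_mono S" for x y
    unfolding S_def using strict_mono_surj_inverse[OF h(2,3)] by auto
  have hmono: "h x \<le> h y" if "x \<le> y" for x y using h(2) that by (simp add: strict_mono_less_eq)
  have Smono: "S x \<le> S y" if "x \<le> y" for x y using S(3) that by (simp add: strict_mono_less_eq)
  have dS: "(S has_real_derivative norm (D a)) (at a)" for a
  proof (rule has_real_derivative_of_arc_length[OF \<phi>(1,2)])
    fix x y :: real assume "x \<le> y"
    then show "norm (\<phi> y - \<phi> x) \<le> S y - S x"
      using arc_length_parametrization_dist_le[OF \<gamma>, of "S y" "S x"] Smono[of x y]
      by (simp add: \<phi>(4) S dist_norm)
  next
    fix x y M :: real assume xy: "x \<le> y" and M: "\<And>s. x \<le> s \<Longrightarrow> s \<le> y \<Longrightarrow> norm (D s) \<le> M"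
    have "S y - S x \<le> M * (h (S y) - h (S x))"
    proof (rule arc_length_parametrization_le[OF \<gamma> Smono[OF xy]])
      fix p q assume pq: "S x \<le> p" "p \<le> q" "q \<le> S y"
      then have b: "x \<le> h p" "h q \<le> y" using hmono[of "S x" p] hmono[of q "S y"] by (auto simp: S)
      have "norm (\<phi> (h q) - \<phi> (h p)) \<le> M * norm (h q - h p)"
      proof (rule differentiable_bound[of "{h p..h q}" \<phi> "\<lambda>s r. r *\<^sub>R D s"])
        show "(\<phi> has_derivative (\<lambda>r. r *\<^sub>R D s)) (at s within {h p..h q})" for s
          using \<phi>(1)[of s] by (simp add: has_vector_derivative_def has_derivative_at_withinI)
        fix s assume "s \<in> {h p..h q}"
        then have "norm (D s) \<le> M" using b by (intro M) auto
        then show "onorm (\<lambda>r. r *\<^sub>R D s) \<le> M"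
          by (intro onorm_le) (simp add: mult.commute[of M] mult_left_mono)
      qed (use hmono[OF pq(2)] in auto)
      then show "dist (\<gamma> p) (\<gamma> q) \<le> M * (h q - h p)"
        using hmono[OF pq(2)] by (simp add: \<phi>(4) dist_norm norm_minus_commute)
    qed
    then show "S y - S x \<le> M * (y - x)" by (simp add: S)
  qed
  have dh: "(h has_real_derivative inverse (norm (D (h t)))) (at t)" for t
  proof (rule DERIV_inverse_function[where f = S and a = "t - 1" and b = "t + 1"])
    show "(S has_real_derivative norm (D (h t))) (at (h t))" by (rule dS)
    show "isCont h t" using h(1) by (simp add: continuous_on_eq_continuous_at)
  qed (use \<phi>(3) S in auto)
  show ?thesis
  proof
    fix t
    have "(\<phi> \<circ> h has_vector_derivative inverse (norm (D (h t))) *\<^sub>R D (h t)) (at t)"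
      using dh[of t] \<phi>(1)
      by (intro vector_diff_chain_at) (simp_all add: has_real_derivative_iff_has_vector_derivative)
    moreover have "\<phi> \<circ> h = \<gamma>" using \<phi>(4) by (simp add: fun_eq_iff)
    ultimately show "(\<gamma> has_vector_derivative inverse (norm (D (h t))) *\<^sub>R D (h t)) (at t)" by simp
    show "norm (inverse (norm (D (h t))) *\<^sub>R D (h t)) = 1" using \<phi>(3) by simp
  next
    have "continuous_on UNIV (\<lambda>t. D (h t))" by (rule continuous_on_compose2[OF \<phi>(2) h(1)]) simp
    then show "continuous_on UNIV (\<lambda>t. inverse (norm (D (h t))) *\<^sub>R D (h t))"
      using \<phi>(3) by (intro continuous_intros) auto
  qed
qed

subsection \<open>Central symmetry\<close>

lemma interior_point_reflection:
  fixes c :: "'a::real_normed_vector"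
  assumes K: "(\<lambda>x. 2 *\<^sub>R c - x) ` K = K" and x: "x \<in> interior K"
  shows "2 *\<^sub>R c - x \<in> interior K"
proof -
  obtain e where e: "0 < e" "ball x e \<subseteq> K" using x by (auto simp: mem_interior)
  have "ball (2 *\<^sub>R c - x) e \<subseteq> K"
  proof
    fix y assume y: "y \<in> ball (2 *\<^sub>R c - x) e"
    have "x - (2 *\<^sub>R c - y) = - (2 *\<^sub>R c - x - y)" by simp
    then have "dist x (2 *\<^sub>R c - y) = dist (2 *\<^sub>R c - x) y" unfolding dist_norm by (metis norm_minus_cancel)
    then have "2 *\<^sub>R c - y \<in> K" using e y by auto
    then have "2 *\<^sub>R c - (2 *\<^sub>R c - y) \<in> K" using K by blast
    then show "y \<in> K" by simp
  qed
  then show ?thesis using e(1) by (auto simp: mem_interior)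
qed

lemma center_in_interior:
  fixes c :: "'a::real_normed_vector"
  assumes "(\<lambda>x. 2 *\<^sub>R c - x) ` K = K" "convex K" "interior K \<noteq> {}"
  shows "c \<in> interior K"
proof -
  obtain x where x: "x \<in> interior K" using assms(3) by auto
  have "(1/2) *\<^sub>R x + (1/2) *\<^sub>R (2 *\<^sub>R c - x) \<in> interior K"
    using assms(2) x interior_point_reflection[OF assms(1) x]
    by (intro convexD[OF convex_interior]) auto
  then show ?thesis by (simp add: scaleR_diff_right)
qed

lemma frontier_reflection:
  fixes c :: "'a::real_normed_vector"
  assumes K: "(\<lambda>x. 2 *\<^sub>R c - x) ` K = K" and "closed K"
  shows "(\<lambda>x. 2 *\<^sub>R c - x) ` frontier K = frontier K"
proof -
  have sub: "2 *\<^sub>R c - x \<in> frontier K" if "x \<in> frontier K" for x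
    using that interior_point_reflection[OF K, of "2 *\<^sub>R c - x"] K assms(2)
    by (auto simp: frontier_def)
  show ?thesis
  proof
    show "(\<lambda>x. 2 *\<^sub>R c - x) ` frontier K \<subseteq> frontier K" using sub by auto
    show "frontier K \<subseteq> (\<lambda>x. 2 *\<^sub>R c - x) ` frontier K"
    proof
      fix x assume "x \<in> frontier K"
      then show "x \<in> (\<lambda>x. 2 *\<^sub>R c - x) ` frontier K"
        using sub[of x] by (intro image_eqI[of _ _ "2 *\<^sub>R c - x"]) auto
    qed
  qed
qed

text \<open>The curve \<open>\<psi>\<close> is 1-Lipschitz, so the arc of \<open>\<gamma>\<close>
  over \<open>{s..t}\<close>, of length \<open>t - s\<close>, is no longer than
  \<open>h t - h s\<close>. Used for a parameter change and for its inverse, this makes the change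
  an isometry.\<close>

lemma arc_length_reparametrization_expands:
  assumes "arc_length_parametrization \<gamma> P K" "\<And>t. \<gamma> t = \<psi> (h t)"
    and "\<And>s t. dist (\<psi> s) (\<psi> t) \<le> \<bar>t - s\<bar>" "mono h" "s \<le> t"
  shows "t - s \<le> h t - h s"
proof -
  have "t - s \<le> 1 * (h t - h s)"
  proof (rule arc_length_parametrization_le[OF assms(1,5)])
    fix x y :: real assume "x \<le> y"
    then have "h x \<le> h y" using assms(4) by (auto dest: monoD)
    then show "dist (\<gamma> x) (\<gamma> y) \<le> 1 * (h y - h x)" using assms(3)[of "h x" "h y"] by (simp add: assms(2))
  qed
  then show ?thesis by simp
qed

text \<open>The reflected curve is again an arc length parametrization, so it is
  \<open>\<gamma>\<close> after a shift or a reversal of the parameter. A reversal has a fixed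
  parameter, which would put the center on the boundary. A shift applied twice is a multiple of
  \<open>P\<close>; even multiples again put the center on the boundary, and odd ones give
  \<open>P / 2\<close>.\<close>

lemma antipodal_boundary_point:
  assumes \<gamma>: "arc_length_parametrization \<gamma> P K"
    and K: "(\<lambda>x. 2 *\<^sub>R c - x) ` K = K" "closed K" "c \<in> interior K"
  shows "\<gamma> (t + P / 2) = 2 *\<^sub>R c - \<gamma> t"
proof -
  define \<gamma>' where "\<gamma>' t = 2 *\<^sub>R c - \<gamma> t" for t
  have \<gamma>b: "parametrizes_boundary \<gamma> P K" using \<gamma> by (simp add: arc_length_parametrization_def)
  have nc: "\<gamma> t \<noteq> c" for t
    using \<gamma>b K(3) by (metis DiffD2 frontier_def parametrizes_boundary_def rangeI)
  have \<gamma>'b: "parametrizes_boundary \<gamma>' P K"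
    using \<gamma>b frontier_reflection[OF K(1,2)]
    by (auto simp: parametrizes_boundary_def \<gamma>'_def inj_on_def image_image[symmetric])
  have dist': "dist (\<gamma>' s) (\<gamma>' t) = dist (\<gamma> s) (\<gamma> t)" for s t
    by (simp add: \<gamma>'_def dist_norm norm_minus_commute)
  have \<gamma>': "arc_length_parametrization \<gamma>' P K"
    using \<gamma> \<gamma>'b by (simp add: arc_length_parametrization_def arc_length_def dist')
  note lip = arc_length_parametrization_dist_le[OF \<gamma>] and lip' = arc_length_parametrization_dist_le[OF \<gamma>']
  obtain h where h: "continuous_on UNIV h" "strict_mono h" "surj h"
    "(\<forall>t. \<gamma>' t = \<gamma> (h t)) \<or> (\<forall>t. \<gamma>' t = \<gamma> (- h t))"
    using boundary_reparametrization[OF \<gamma>b arc_length_parametrization_continuous[OF \<gamma>] \<gamma>'b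
        arc_length_parametrization_continuous[OF \<gamma>']] .
  define S where "S = inv h"
  have S: "h (S y) = y" "S (h x) = x" "strict_mono S" for x y
    unfolding S_def using strict_mono_surj_inverse[OF h(2,3)] by auto
  have hm: "mono h" "mono S" using h(2) S(3) by (simp_all add: strict_mono_mono)
  have isom: "h t = h 0 + t"
    if 1: "\<And>s t. s \<le> t \<Longrightarrow> t - s \<le> h t - h s" and 2: "\<And>s t. s \<le> t \<Longrightarrow> t - s \<le> S t - S s" for t
  proof -
    have "h t - h s = t - s" if "s \<le> t" for s t
      using 1[OF that] 2[OF monoD[OF hm(1) that]] by (simp add: S)
    from this[of 0 t] this[of t 0] show ?thesis by linarith
  qed
  have P: "0 < P" using \<gamma>b by (simp add: parametrizes_boundary_def)
  show ?thesis
  proof (cases "\<forall>t. \<gamma>' t = \<gamma> (h t)")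
    case True
    have t1: "t - s \<le> h t - h s" if "s \<le> t" for s t
      by (rule arc_length_reparametrization_expands[OF \<gamma>' _ lip hm(1) that]) (use True in auto)
    have t2: "t - s \<le> S t - S s" if "s \<le> t" for s t
      by (rule arc_length_reparametrization_expands[OF \<gamma> _ lip' hm(2) that]) (use True S in auto)
    have e: "2 *\<^sub>R c - \<gamma> t = \<gamma> (t + h 0)" for t
      using True isom[OF t1 t2, of t] by (simp add: \<gamma>'_def add.commute)
    have "\<gamma> (0 + h 0 + h 0) = \<gamma> 0" using e[of 0] e[of "0 + h 0"] by (metis diff_diff_eq2 diff_add_cancel add_diff_cancel_left')
    then obtain n :: int where n: "2 * h 0 = of_int n * P"
      using parametrizes_boundary_eq_iff[OF \<gamma>b, of 0 "0 + h 0 + h 0"] by auto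
    show ?thesis
    proof (cases "even n")
      case True
      then obtain k where "n = 2 * k" by (elim evenE)
      then have "h 0 = of_int k * P" using n by simp
      then have "2 *\<^sub>R c - \<gamma> 0 = \<gamma> 0"
        using e[of 0] parametrizes_boundary_shift_int[OF \<gamma>b, of 0 k] by simp
      then have "2 *\<^sub>R c = 2 *\<^sub>R \<gamma> 0" by (simp add: scaleR_2 algebra_simps)
      then have "c = \<gamma> 0" by simp
      then show ?thesis using nc by metis
    next
      case False
      then obtain k where "n = 2 * k + 1" by (elim oddE)
      then have "t + h 0 = t + P / 2 + of_int k * P" using n by (simp add: algebra_simps)
      then show ?thesis using e[of t] parametrizes_boundary_shift_int[OF \<gamma>b, of "t + P / 2" k] by metis
    qed
  next
    case False
    then have F: "\<gamma>' t = \<gamma> (- h t)" for t using h(4) by blast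
    have t1: "t - s \<le> h t - h s" if "s \<le> t" for s t
    proof (rule arc_length_reparametrization_expands[OF \<gamma>' F _ hm(1) that])
      show "dist (\<gamma> (- x)) (\<gamma> (- y)) \<le> \<bar>y - x\<bar>" for x y using lip[of "- x" "- y"] by simp
    qed
    have t2: "t - s \<le> S t - S s" if "s \<le> t" for s t
    proof -
      have "(- s) - (- t) \<le> - S (- (- s)) - - S (- (- t))"
      proof (rule arc_length_reparametrization_expands[where h = "\<lambda>x. - S (- x)" and \<psi> = "\<lambda>x. \<gamma>' (- x)", OF \<gamma>])
        show "\<gamma> x = \<gamma>' (- (- S (- x)))" for x using F[of "S (- x)"] S by simp
        show "dist (\<gamma>' (- x)) (\<gamma>' (- y)) \<le> \<bar>y - x\<bar>" for x y using lip'[of "- x" "- y"] by simp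
        show "mono (\<lambda>x. - S (- x))" using hm(2) by (auto simp: mono_def)
      qed (use that in auto)
      then show ?thesis by simp
    qed
    have "2 *\<^sub>R c - \<gamma> (- h 0 / 2) = \<gamma> (- h 0 / 2)"
    proof -
      have e: "- h (- h 0 / 2) = - h 0 / 2" using isom[OF t1 t2, of "- h 0 / 2"] by simp
      show ?thesis using F[of "- h 0 / 2"] unfolding \<gamma>'_def e .
    qed
    then have "2 *\<^sub>R c = 2 *\<^sub>R \<gamma> (- h 0 / 2)" by (simp add: scaleR_2 algebra_simps)
    then have "c = \<gamma> (- h 0 / 2)" by simp
    then show ?thesis using nc by metis
  qed
qed

subsection \<open>The tangent line supports the body\<close>

definition to_complex :: "real ^ 2 \<Rightarrow> complex" where "to_complex x = Complex (x $ 1) (x $ 2)"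

lemma bounded_linear_to_complex: "bounded_linear to_complex"
  unfolding linear_conv_bounded_linear[symmetric]
  by (rule linearI) (simp_all add: to_complex_def complex_eq_iff)

lemma norm_to_complex: "norm (to_complex x) = norm x"
  by (simp add: to_complex_def complex_norm norm_vec_def L2_set_def sum_2)

lemma Im_cnj_to_complex: "Im (cnj (to_complex v) * to_complex x) = v $ 1 * x $ 2 - v $ 2 * x $ 1"
  by (simp add: to_complex_def)

lemma to_complex_diff: "to_complex (x - y) = to_complex x - to_complex y"
  by (simp add: to_complex_def complex_eq_iff)

text \<open>A normal \<open>n\<close> of a supporting line at \<open>\<gamma> t\<close> is
  orthogonal to \<open>v\<close>, because \<open>n \<bullet> \<gamma> s\<close> is minimal at
  \<open>s = t\<close>. Strict convexity makes the support strict, through the midpoint of the chord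
  to \<open>y\<close>. The sign of \<open>\<mu>\<close> records on which side the body lies.\<close>

lemma tangent_supports:
  assumes K: "planar_body K" "strictly_convex K"
    and \<gamma>: "range \<gamma> = frontier K" "(\<gamma> has_vector_derivative v) (at t)" "norm v = 1"
  obtains \<mu> where "\<And>y. y \<in> K \<Longrightarrow> y \<noteq> \<gamma> t \<Longrightarrow> 0 < \<mu> * Im (cnj (to_complex v) * to_complex (y - \<gamma> t))"
proof -
  have cK: "closed K" "convex K" and iK: "interior K \<noteq> {}"
    using K(1) by (auto simp: planar_body_def compact_imp_closed)
  have fr: "\<gamma> s \<in> K - interior K" for s using \<gamma>(1) cK by (auto simp: frontier_def)
  have "rel_interior K = interior K" using iK by (rule rel_interior_nonempty_interior)
  then obtain n where n: "\<And>y. y \<in> K \<Longrightarrow> n \<bullet> \<gamma> t \<le> n \<bullet> y"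
    "\<And>y. y \<in> interior K \<Longrightarrow> n \<bullet> \<gamma> t < n \<bullet> y"
    using supporting_hyperplane_rel_boundary[of K "\<gamma> t"] cK(2) fr[of t] by (metis Diff_iff)
  have strict: "0 < n \<bullet> (y - \<gamma> t)" if y: "y \<in> K" "y \<noteq> \<gamma> t" for y
  proof -
    have "midpoint (\<gamma> t) y \<in> open_segment (\<gamma> t) y" using y by simp
    moreover have "open_segment (\<gamma> t) y \<subseteq> interior K"
      using K(2) fr[of t] y unfolding strictly_convex_def by (metis DiffD1)
    ultimately have "midpoint (\<gamma> t) y \<in> interior K" by blast
    then have "n \<bullet> \<gamma> t < n \<bullet> midpoint (\<gamma> t) y" by (rule n(2))
    then show ?thesis by (simp add: midpoint_def inner_add_right inner_diff_right)
  qed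
  have "((\<lambda>s. n \<bullet> \<gamma> s) has_real_derivative n \<bullet> v) (at t)"
    using bounded_linear.has_vector_derivative[OF bounded_linear_inner_right \<gamma>(2), of n]
    by (simp add: has_real_derivative_iff_has_vector_derivative)
  then have "n \<bullet> v = 0"
    by (rule DERIV_local_min[where d = 1]) (use n(1) fr in auto)
  then have nv: "n $ 1 * v $ 1 + n $ 2 * v $ 2 = 0" by (simp add: inner_vec_def sum_2)
  have v1: "(v $ 1)\<^sup>2 + (v $ 2)\<^sup>2 = 1" using \<gamma>(3) by (simp add: norm_vec_def L2_set_def sum_2)
  \<comment> \<open>The coordinate of \<open>n\<close> along \<open>v\<close> rotated by a quarter
    turn.\<close>
  define \<mu> where "\<mu> = n $ 2 * v $ 1 - n $ 1 * v $ 2"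
  have "\<mu> * v $ 1 = n $ 2 * ((v $ 1)\<^sup>2 + (v $ 2)\<^sup>2) - v $ 2 * (n $ 1 * v $ 1 + n $ 2 * v $ 2)"
    "- \<mu> * v $ 2 = n $ 1 * ((v $ 1)\<^sup>2 + (v $ 2)\<^sup>2) - v $ 1 * (n $ 1 * v $ 1 + n $ 2 * v $ 2)"
    by (simp_all add: \<mu>_def algebra_simps power2_eq_square)
  then have n12: "n $ 2 = \<mu> * v $ 1" "n $ 1 = - \<mu> * v $ 2" using nv v1 by auto
  have "n \<bullet> x = \<mu> * Im (cnj (to_complex v) * to_complex x)" for x
    unfolding Im_cnj_to_complex by (simp add: inner_vec_def sum_2 n12 algebra_simps)
  then show ?thesis using strict that by metis
qed

section \<open>Reduction of the body to the normal form\<close>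

theorem theorem1:
  fixes K :: "(real ^ 2) set" and \<sigma> :: real
  assumes "planar_body K"
    and "centrally_symmetric K"
    and "strictly_convex K"
    and "C1_boundary K"
    and "\<sigma> = 1 / 8 \<or> \<sigma> = 3 / 8"
    and "floats_in_equilibrium K \<sigma>"
  shows "\<exists>c r. 0 < r \<and> K = cball c r"
proof -
  have K: "compact K" "convex K" "interior K \<noteq> {}" using assms(1) by (auto simp: planar_body_def)
  then have cl: "closed K" by (simp add: compact_imp_closed)
  obtain c where c: "(\<lambda>x. 2 *\<^sub>R c - x) ` K = K" using assms(2) by (auto simp: centrally_symmetric_def)
  have cK: "c \<in> interior K" by (rule center_in_interior[OF c K(2,3)])
  obtain \<gamma> P d where \<gamma>: "arc_length_parametrization \<gamma> P K"
    and d: "\<And>t. norm (\<gamma> (t + \<sigma> * P) - \<gamma> t) = d"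
    using assms(6) by (auto simp: floats_in_equilibrium_def)
  have \<gamma>b: "parametrizes_boundary \<gamma> P K" using \<gamma> by (simp add: arc_length_parametrization_def)
  then have P: "0 < P" and rng: "range \<gamma> = frontier K" by (auto simp: parametrizes_boundary_def)
  have fr: "\<gamma> t \<in> K - interior K" for t using rng cl by (auto simp: frontier_def)
  obtain v where v: "\<And>t. (\<gamma> has_vector_derivative v t) (at t)" "continuous_on UNIV v" "\<And>t. norm (v t) = 1"
    using arc_length_parametrization_C1[OF assms(4) \<gamma>] by blast
  note antipode = antipodal_boundary_point[OF \<gamma> c cl cK]
  define g where "g t = to_complex (\<gamma> t - c)" for t
  define w where "w t = to_complex (v t)" for t
  have g_diff: "g s - g t = to_complex (\<gamma> s - \<gamma> t)" for s t
    by (simp add: g_def flip: to_complex_diff)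
  have "\<exists>\<mu>. \<forall>y\<in>K. y \<noteq> \<gamma> t \<longrightarrow> 0 < \<mu> * Im (cnj (w t) * to_complex (y - \<gamma> t))" for t
    using tangent_supports[OF assms(1,3) rng v(1) v(3), of t] unfolding w_def by metis
  then obtain \<mu> where \<mu>: "\<And>t y. y \<in> K \<Longrightarrow> y \<noteq> \<gamma> t \<Longrightarrow> 0 < \<mu> t * Im (cnj (w t) * to_complex (y - \<gamma> t))"
    by metis
  \<comment> \<open>The signed distance of the center from the tangent line. It is continuous and
    never zero, so its sign, and with it the side on which the body lies, is the same for all
    \<open>t\<close>.\<close>
  define f where "f t = Im (cnj (w t) * to_complex (c - \<gamma> t))" for t
  have \<mu>f: "0 < \<mu> t * f t" for t
    unfolding f_def using cK interior_subset fr[of t] by (intro \<mu>) auto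
  have chord_side: "0 < \<mu> t * Im (cnj (w t) * (g (t + \<tau>) - g t))" if "0 < \<tau>" "\<tau> < P" for t \<tau>
  proof -
    have "\<gamma> (t + \<tau>) \<noteq> \<gamma> t"
    proof
      assume "\<gamma> (t + \<tau>) = \<gamma> t"
      then obtain k :: int where "\<tau> = of_int k * P"
        using parametrizes_boundary_eq_iff[OF \<gamma>b, of t "t + \<tau>"] by auto
      then have "0 < k" "k < 1" using that P by (simp_all add: zero_less_mult_iff)
      then show False by simp
    qed
    then show ?thesis unfolding g_diff using fr by (intro \<mu>) auto
  qed
  have w: "continuous_on UNIV w" "\<And>t. norm (w t) = 1"
    unfolding w_def using v
    by (auto simp: norm_to_complex intro!: bounded_linear.continuous_on[OF bounded_linear_to_complex])
  have g: "(g has_vector_derivative w t) (at t)" for t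
    unfolding g_def w_def
    by (rule bounded_linear.has_vector_derivative[OF bounded_linear_to_complex])
      (use v(1)[of t] in \<open>auto intro!: derivative_eq_intros\<close>)
  have g_antipode: "g (t + P / 2) = - g t" for t
    unfolding g_def antipode by (simp add: to_complex_def complex_eq_iff scaleR_2)
  have g_chord: "norm (g (t + \<sigma> * P) - g t) = d" for t
    unfolding g_diff norm_to_complex by (rule d)
  have \<sigma>: "0 < \<sigma>" "\<sigma> < 1 / 2" using assms(5) by auto
  have "continuous_on UNIV f"
    unfolding f_def using w(1) arc_length_parametrization_continuous[OF \<gamma>, of UNIV]
    by (intro continuous_intros bounded_linear.continuous_on[OF bounded_linear_to_complex])
  then have "connected (range f)" by (intro connected_continuous_image connected_UNIV)
  moreover have "f t \<noteq> 0" for t using \<mu>f[of t] by auto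
  ultimately have f_sign: "(\<forall>t. 0 < f t) \<or> (\<forall>t. f t < 0)"
    using connectedD_interval[of "range f" _ _ 0] by (metis linorder_neqE_linordered_idom less_imp_le rangeE rangeI)
  have "norm (g t) = norm (g 0)" for t
    using f_sign
  proof
    assume "\<forall>t. 0 < f t"
    then have "0 < \<mu> t" for t using \<mu>f[of t] by (simp add: zero_less_mult_iff) (metis less_asym)
    then have "0 < Im (cnj (w t) * (g (t + \<tau>) - g t))" if "0 < \<tau>" "\<tau> < P" for t \<tau>
      using chord_side[OF that] by (meson zero_less_mult_pos)
    then have "eighth_oval g w P d \<sigma>"
      by (intro eighth_oval.intro equichordal_oval.intro eighth_oval_axioms.intro)
        (rule P g w g_antipode \<sigma> g_chord assms(5) | assumption)+
    then show ?thesis by (rule eighth_oval.norm_const)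
  next
    assume "\<forall>t. f t < 0"
    then have \<mu>neg: "\<mu> t < 0" for t using \<mu>f[of t] by (simp add: zero_less_mult_iff) (metis less_asym)
    \<comment> \<open>For a clockwise curve, complex conjugation restores the counterclockwise
      orientation and preserves norms.\<close>
    have "eighth_oval (\<lambda>t. cnj (g t)) (\<lambda>t. cnj (w t)) P d \<sigma>"
    proof
      show "((\<lambda>t. cnj (g t)) has_vector_derivative cnj (w t)) (at t)" for t
        by (rule bounded_linear.has_vector_derivative[OF bounded_linear_cnj g])
      show "continuous_on UNIV (\<lambda>t. cnj (w t))" by (intro continuous_intros w)
      fix t \<tau> assume "0 < \<tau>" "\<tau> < P"
      then have "Im (cnj (w t) * (g (t + \<tau>) - g t)) < 0"
        using chord_side[of \<tau> t] \<mu>neg[of t] by (auto simp: zero_less_mult_iff)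
      moreover have "cnj (cnj (w t)) * (cnj (g (t + \<tau>)) - cnj (g t)) = cnj (cnj (w t) * (g (t + \<tau>) - g t))"
        by simp
      ultimately show "0 < Im (cnj (cnj (w t)) * (cnj (g (t + \<tau>)) - cnj (g t)))" by (metis cnj.simps(2) neg_0_less_iff_less)
    next
      show "norm (cnj (g (t + \<sigma> * P)) - cnj (g t)) = d" for t
        using g_chord[of t] by (metis complex_cnj_diff complex_mod_cnj)
    qed (use P w g_antipode \<sigma> assms(5) in auto)
    from eighth_oval.norm_const[OF this] show ?thesis by simp
  qed
  then have "frontier K \<subseteq> sphere c (norm (g 0))"
    unfolding rng[symmetric] by (auto simp: g_def norm_to_complex dist_norm norm_minus_commute)
  from eq_cball_of_frontier_subset_sphere[OF K(1,2) cK this]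
  have "0 < norm (g 0) \<and> K = cball c (norm (g 0))" by simp
  then show ?thesis by blast
qed

end
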